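(* Let $T\in(0,\infty)$ and let $\big(\Omega,\mathscr{F},(\mathscr{F}_t)_{t\in[0,T]},\mathbf{P}\big)$ be a complete filtered probability space with $\mathscr{F}_T=\mathscr{F}$, whose filtration satisfies the usual conditions (right-continuity and completeness). Let $d\in\mathbb{N}$ and let $S=(S^1_t,\ldots,S^d_t)_{t\in[0,T]}$ be an adapted $d$-dimensional process with continuous paths and values in $(0,\infty)^d$. If $S$ is sticky, then for every $\varepsilon>0$ the process $S$ admits an $\varepsilon$-consistent price system.
   Context: For $x\in\mathbb{R}^d$ let $\|x\|=\max(|x_1|,\ldots,|x_d|)$. For a stopping time $\tau\in[0,T]$ write $S^\star_\tau=\sup_{u\in[\tau,T]}\|S_u-S_\tau\|$. The process $S$ is called sticky if for every deterministic $t\in[0,T)$ and every $\delta>0$, $\mathbf{P}[S^\star_t<\delta\mid\mathscr{F}_t]>0$ almost surely. An adapted $d$-dimensional process $(M_t)_{t\in[0,T]}$ is an $\varepsilon$-consistent price system for $S$ if for every $i\in\{1,\ldots,d\}$ and $t\in[0,T]$ one has $\frac{S^i_t}{1+\varepsilon}\le M^i_t\le(1+\varepsilon)S^i_t$ almost surely, and there exists a probability measure $\mathbf{Q}$ on $(\Omega,\mathscr{F})$ with $\mathbf{Q}\sim\mathbf{P}$ such that $M$ is a $\mathbf{Q}$-martingale. *)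

theory Defs
  imports "HOL-Probability.Probability"
begin

definition maxnorm :: "real ^ 'd \<Rightarrow> real" where
  "maxnorm x = (MAX i \<in> UNIV. \<bar>x $ i\<bar>)"

definition usual_filtered_prob_space ::
  "'a measure \<Rightarrow> (real \<Rightarrow> 'a measure) \<Rightarrow> real \<Rightarrow> bool" where
  "usual_filtered_prob_space P F T \<longleftrightarrow>
     prob_space P \<and> complete_measure P \<and>
     (\<forall>t\<in>{0..T}. space (F t) = space P \<and> sets (F t) \<subseteq> sets P) \<and>
     (\<forall>s\<in>{0..T}. \<forall>t\<in>{0..T}. s \<le> t \<longrightarrow> sets (F s) \<subseteq> sets (F t)) \<and>
     sets (F T) = sets P \<and>
     null_sets P \<subseteq> sets (F 0) \<and>
     (\<forall>t\<in>{0..<T}. sets (F t) = (\<Inter>s\<in>{t<..T}. sets (F s)))"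

definition adapted :: "(real \<Rightarrow> 'a measure) \<Rightarrow> real \<Rightarrow> (real \<Rightarrow> 'a \<Rightarrow> real ^ 'd) \<Rightarrow> bool" where
  "adapted F T X \<longleftrightarrow> (\<forall>t\<in>{0..T}. X t \<in> borel_measurable (F t))"

definition Sstar :: "real \<Rightarrow> (real \<Rightarrow> 'a \<Rightarrow> real ^ 'd) \<Rightarrow> real \<Rightarrow> 'a \<Rightarrow> real" where
  "Sstar T S t \<omega> = (SUP u\<in>{t..T}. maxnorm (S u \<omega> - S t \<omega>))"

definition sticky :: "'a measure \<Rightarrow> (real \<Rightarrow> 'a measure) \<Rightarrow> real \<Rightarrow> (real \<Rightarrow> 'a \<Rightarrow> real ^ 'd) \<Rightarrow> bool" where
  "sticky P F T S \<longleftrightarrow>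
     (\<forall>t\<in>{0..<T}. \<forall>\<delta>>0.
        AE \<omega> in P. real_cond_exp P (F t)
           (indicator {\<omega>\<in>space P. Sstar T S t \<omega> < \<delta>}) \<omega> > 0)"

definition martingale :: "'a measure \<Rightarrow> (real \<Rightarrow> 'a measure) \<Rightarrow> real \<Rightarrow> (real \<Rightarrow> 'a \<Rightarrow> real ^ 'd) \<Rightarrow> bool" where
  "martingale Q F T X \<longleftrightarrow> adapted F T X \<and>
     (\<forall>t\<in>{0..T}. \<forall>i. integrable Q (\<lambda>\<omega>. X t \<omega> $ i)) \<and>
     (\<forall>s\<in>{0..T}. \<forall>t\<in>{0..T}. s \<le> t \<longrightarrow> (\<forall>i.
        AE \<omega> in Q. real_cond_exp Q (F s) (\<lambda>\<omega>. X t \<omega> $ i) \<omega> = X s \<omega> $ i))"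

definition eps_CPS :: "'a measure \<Rightarrow> (real \<Rightarrow> 'a measure) \<Rightarrow> real \<Rightarrow> real \<Rightarrow>
    (real \<Rightarrow> 'a \<Rightarrow> real ^ 'd) \<Rightarrow> (real \<Rightarrow> 'a \<Rightarrow> real ^ 'd) \<Rightarrow> bool" where
  "eps_CPS P F T \<epsilon> S M \<longleftrightarrow> adapted F T M \<and>
     (\<forall>i. \<forall>t\<in>{0..T}. AE \<omega> in P. S t \<omega> $ i / (1 + \<epsilon>) \<le> M t \<omega> $ i \<and> M t \<omega> $ i \<le> (1 + \<epsilon>) * S t \<omega> $ i) \<and>
     (\<exists>Q. prob_space Q \<and> space Q = space P \<and> sets Q = sets P \<and>
          absolutely_continuous P Q \<and> absolutely_continuous Q P \<and> martingale Q F T M)"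

end

theory Submission
  imports Defs
begin

text \<open>
  Let \<open>X\<close> be the coordinatewise logarithm of \<open>S\<close>, let \<open>\<tau> 0 = 0\<close>, and let \<open>\<tau> (k + 1)\<close> be the first
  time after \<open>\<tau> k\<close> at which \<open>X\<close> has moved by \<open>\<delta>\<close>, capped at \<open>T\<close>. By path continuity stickiness
  passes from deterministic times to the \<open>\<tau> k\<close>: on \<open>\<tau> k < T\<close> there is a positive conditional
  probability \<open>p k\<close> of no further exit before \<open>T\<close>. Change the measure with the density equal to
  \<open>w \<eta>\<^sup>k / p k\<close> on the event \<open>E k\<close> that exactly \<open>k\<close> exits occur. For small \<open>\<eta>\<close> further exits become so
  unlikely that a geometric series bounds their contribution, and the conditional expectation of
  \<open>S T\<close> at each \<open>\<tau> k\<close> is within a constant factor near \<open>1\<close> of \<open>S\<close> at \<open>\<tau> k\<close>. A time \<open>t\<close> between two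
  exits is handled by waiting for the next one, since \<open>S\<close> changes only by a factor
  \<open>exp (2 * \<delta>)\<close> until then. Hence the martingale of conditional expectations of \<open>S T\<close> is a consistent
  price system. The weight \<open>w\<close>, measurable at time \<open>0\<close>, makes \<open>S 0\<close> integrable.
\<close>

subsection \<open>Successive exit times of a path\<close>

text \<open>Stickiness gives positivity of \<open>p k\<close> but no lower bound, and conditional
  laws under a changed measure depend on all later steps. Dividing by \<open>p k\<close> settles the
  first point: integrated over \<open>E k\<close>, the density leaves only \<open>w\<close> and a
  power of \<eta>. The second is bypassed by computing no conditional law under the new measure. For
  a set known at \<open>\<tau> k\<close> and contained in \<open>\<tau> k < T\<close>, let U and V
  be the integrals of a price coordinate at \<open>\<tau> k\<close> and at \<open>T\<close> against
  the density. Both are compared with I, which is \<open>\<eta> ^ k\<close> times the integral of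
  \<open>w\<close> and the price at \<open>\<tau> k\<close> under \<open>P\<close>: U lies between I
  and \<open>exp \<delta>\<close> times I, V between \<open>exp (- \<delta>)\<close> and
  \<open>exp (2 * \<delta>)\<close> times I. So U and V agree up to the factor
  \<open>exp (2 * \<delta>)\<close>. A time \<open>t\<close> between exits cannot be treated with
  \<open>p n\<close>, which conditions only on the past of \<open>\<tau> n\<close>: information
  arriving before \<open>t\<close> may change the chance of staying arbitrarily. At the next exit
  the comparison is available again. Waiting costs another \<open>exp (2 * \<delta>)\<close>, hence
  the requirement \<open>exp (4 * \<delta>) = 1 + \<epsilon>\<close>.\<close>

definition next_exit :: "(real \<Rightarrow> 'b::metric_space) \<Rightarrow> real \<Rightarrow> real \<Rightarrow> real \<Rightarrow> real" where
  "next_exit x T \<delta> s = Inf (insert T {u\<in>{s..T}. \<delta> \<le> dist (x u) (x s)})"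

context
  fixes x :: "real \<Rightarrow> 'b::metric_space" and T \<delta> s :: real
  assumes cont: "continuous_on UNIV x" and le: "s \<le> T"
begin

text \<open>By continuity the set of candidates is closed, so its infimum is attained. Inserting
  \<open>T\<close> keeps the set nonempty and supplies the cap.\<close>

lemma next_exit_mem: "next_exit x T \<delta> s \<in> insert T {u\<in>{s..T}. \<delta> \<le> dist (x u) (x s)}"
proof -
  have "closed ({u. \<delta> \<le> dist (x u) (x s)} \<inter> {s..T})"
    by (intro closed_Int closed_Collect_le continuous_on_const continuous_on_dist cont closed_atLeastAtMost)
  moreover have "{u. \<delta> \<le> dist (x u) (x s)} \<inter> {s..T} = {u\<in>{s..T}. \<delta> \<le> dist (x u) (x s)}"
    by auto
  ultimately show ?thesis
    unfolding next_exit_def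
    using le by (intro closed_contains_Inf closed_insert bdd_belowI[of _ s]) auto
qed

lemma next_exit_lower:
  assumes "u \<in> {s..T}" "\<delta> \<le> dist (x u) (x s)"
  shows "next_exit x T \<delta> s \<le> u"
  unfolding next_exit_def
proof (rule cInf_lower)
  show "bdd_below (insert T {u \<in> {s..T}. \<delta> \<le> dist (x u) (x s)})"
    using le by (intro bdd_belowI[of _ s]) auto
qed (use assms in simp)

lemma next_exit_ge: "s \<le> next_exit x T \<delta> s" and next_exit_le: "next_exit x T \<delta> s \<le> T"
  using next_exit_mem le by auto

lemma dist_next_exit: "next_exit x T \<delta> s < T \<Longrightarrow> \<delta> \<le> dist (x (next_exit x T \<delta> s)) (x s)"
  using next_exit_mem by auto

lemma dist_before_next_exit:
  assumes "s \<le> u" "u < next_exit x T \<delta> s"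
  shows "dist (x u) (x s) < \<delta>"
proof (rule ccontr)
  assume "\<not> dist (x u) (x s) < \<delta>"
  with next_exit_lower[of u] next_exit_le assms show False by auto
qed

lemma next_exit_gt:
  assumes "s < T" "0 < \<delta>"
  shows "s < next_exit x T \<delta> s"
  using next_exit_mem assms by (cases "next_exit x T \<delta> s = s") (use next_exit_ge in auto)

text \<open>The strict bound before the exit becomes a weak bound at the exit itself by passing to
  the closure of the half-open interval.\<close>

lemma dist_upto_next_exit:
  assumes "s \<le> u" "u \<le> next_exit x T \<delta> s" "0 < \<delta>"
  shows "dist (x u) (x s) \<le> \<delta>"
proof (cases "s < next_exit x T \<delta> s")
  case True
  have "(\<lambda>u. dist (x u) (x s)) ` closure {s..<next_exit x T \<delta> s} \<subseteq> {..\<delta>}"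
  proof (rule image_closure_subset)
    show "continuous_on (closure {s..<next_exit x T \<delta> s}) (\<lambda>u. dist (x u) (x s))"
      by (intro continuous_intros continuous_on_subset[OF cont]) auto
  qed (use dist_before_next_exit in force)+
  then show ?thesis
    using True assms by (auto simp: image_subset_iff)
next
  case False
  with assms have "u = s" by linarith
  with assms show ?thesis by simp
qed

text \<open>For \<open>t < T\<close> the cap cannot be what makes the exit time at most
  \<open>t\<close>. The stopping time property is read off from this form.\<close>

lemma next_exit_le_iff:
  assumes "t < T"
  shows "next_exit x T \<delta> s \<le> t \<longleftrightarrow> (\<exists>u\<in>{s..t}. \<delta> \<le> dist (x u) (x s))"
proof
  assume "next_exit x T \<delta> s \<le> t"
  with next_exit_mem assms show "\<exists>u\<in>{s..t}. \<delta> \<le> dist (x u) (x s)"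
    by (intro bexI[of _ "next_exit x T \<delta> s"]) auto
next
  assume "\<exists>u\<in>{s..t}. \<delta> \<le> dist (x u) (x s)"
  then obtain u where "u \<in> {s..t}" "\<delta> \<le> dist (x u) (x s)" ..
  with next_exit_lower[of u] assms show "next_exit x T \<delta> s \<le> t" by auto
qed

lemma next_exit_eq_T:
  assumes "\<And>u. u \<in> {s..T} \<Longrightarrow> dist (x u) (x s) < \<delta>"
  shows "next_exit x T \<delta> s = T"
proof (rule ccontr)
  assume "next_exit x T \<delta> s \<noteq> T"
  with next_exit_mem assms[of "next_exit x T \<delta> s"] show False by auto
qed

end

primrec exit_time :: "(real \<Rightarrow> 'b::metric_space) \<Rightarrow> real \<Rightarrow> real \<Rightarrow> nat \<Rightarrow> real" where
  "exit_time x T \<delta> 0 = 0"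
| "exit_time x T \<delta> (Suc k) = next_exit x T \<delta> (exit_time x T \<delta> k)"

context
  fixes x :: "real \<Rightarrow> 'b::metric_space" and T \<delta> :: real
  assumes cont: "continuous_on UNIV x" and T: "0 < T" and \<delta>: "0 < \<delta>"
begin

lemma exit_time_le: "exit_time x T \<delta> k \<le> T"
  using T by (induction k) (simp_all add: next_exit_le[OF cont])

lemma exit_time_mono: "j \<le> k \<Longrightarrow> exit_time x T \<delta> j \<le> exit_time x T \<delta> k"
  by (rule lift_Suc_mono_le[of "exit_time x T \<delta>"])
    (simp_all add: next_exit_ge[OF cont exit_time_le])

lemma exit_time_nonneg: "0 \<le> exit_time x T \<delta> k"
  using exit_time_mono[of 0 k] by simp

text \<open>Otherwise the increasing bounded sequence of exit times converges. Continuity at the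
  limit then forces consecutive path values together, although they stay \<delta> apart.\<close>

lemma exit_time_eventually: "\<exists>k. exit_time x T \<delta> k = T"
proof (rule ccontr)
  let ?\<tau> = "exit_time x T \<delta>"
  assume "\<not> (\<exists>k. exit_time x T \<delta> k = T)"
  then have less: "?\<tau> k < T" for k
    using exit_time_le[of k] by (metis order_le_less)
  obtain l where l: "?\<tau> \<longlonglongrightarrow> l"
    using incseq_convergent[of ?\<tau> T] exit_time_le exit_time_mono by (metis incseq_def)
  have "isCont x l"
    using cont by (simp add: continuous_on_eq_continuous_at)
  then have "(\<lambda>k. x (?\<tau> k)) \<longlonglongrightarrow> x l"
    using l isCont_tendsto_compose by blast
  then have "(\<lambda>k. dist (x (?\<tau> (Suc k))) (x (?\<tau> k))) \<longlonglongrightarrow> dist (x l) (x l)"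
    by (intro tendsto_dist LIMSEQ_Suc)
  moreover have "\<delta> \<le> dist (x (?\<tau> (Suc k))) (x (?\<tau> k))" for k
    using dist_next_exit[OF cont exit_time_le, of \<delta> k] less[of "Suc k"] by simp
  ultimately have "\<delta> \<le> dist (x l) (x l)"
    by (intro LIMSEQ_le_const) auto
  with \<delta> show False by simp
qed

lemma exit_time_unique:
  assumes "0 \<le> t" "t < T"
  shows "\<exists>!k. exit_time x T \<delta> k \<le> t \<and> t < exit_time x T \<delta> (Suc k)"
proof -
  let ?m = "LEAST k. t < exit_time x T \<delta> k"
  have ex: "\<exists>k. t < exit_time x T \<delta> k"
    using exit_time_eventually assms by metis
  have "?m \<noteq> 0"
    using LeastI_ex[OF ex] assms by (metis exit_time.simps(1) not_le)
  then obtain k where k: "?m = Suc k"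
    using not0_implies_Suc by blast
  have "t < exit_time x T \<delta> (Suc k)"
    using LeastI_ex[OF ex] k by simp
  moreover have "exit_time x T \<delta> k \<le> t"
    using not_less_Least[of k "\<lambda>k. t < exit_time x T \<delta> k"] k by simp
  moreover have "i = j" if "exit_time x T \<delta> i \<le> t" "t < exit_time x T \<delta> (Suc i)"
    "exit_time x T \<delta> j \<le> t" "t < exit_time x T \<delta> (Suc j)" for i j
  proof (rule linorder_cases[of i j])
    assume "i < j"
    with that exit_time_mono[of "Suc i" j] show ?thesis by simp
  next
    assume "j < i"
    with that exit_time_mono[of "Suc j" i] show ?thesis by simp
  qed
  ultimately show ?thesis by blast
qed

text \<open>Once \<open>T\<close> is reached the sequence stays there, so only the condition
  \<open>exit_time x T \<delta> k < T\<close> singles out the last step.\<close>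

lemma exit_time_unique_last:
  "\<exists>!k. exit_time x T \<delta> k < T \<and> exit_time x T \<delta> (Suc k) = T"
proof -
  let ?m = "LEAST k. exit_time x T \<delta> k = T"
  have "?m \<noteq> 0"
    using LeastI_ex[OF exit_time_eventually] T by (metis exit_time.simps(1) less_irrefl)
  then obtain k where k: "?m = Suc k"
    using not0_implies_Suc by blast
  have "exit_time x T \<delta> (Suc k) = T"
    using LeastI_ex[OF exit_time_eventually] k by simp
  moreover have "exit_time x T \<delta> k < T"
    using not_less_Least[of k "\<lambda>k. exit_time x T \<delta> k = T"] k exit_time_le[of k] by simp
  moreover have "i = j" if "exit_time x T \<delta> i < T" "exit_time x T \<delta> (Suc i) = T"
    "exit_time x T \<delta> j < T" "exit_time x T \<delta> (Suc j) = T" for i j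
  proof (rule linorder_cases[of i j])
    assume "i < j"
    with that exit_time_mono[of "Suc i" j] show ?thesis by simp
  next
    assume "j < i"
    with that exit_time_mono[of "Suc j" i] show ?thesis by simp
  qed
  ultimately show ?thesis by blast
qed

lemma dist_exit_time:
  assumes "exit_time x T \<delta> k \<le> u" "u \<le> exit_time x T \<delta> (Suc k)"
  shows "dist (x u) (x (exit_time x T \<delta> k)) \<le> \<delta>"
  using assms dist_upto_next_exit[OF cont exit_time_le _ _ \<delta>] by simp

lemma dist_exit_times: "dist (x (exit_time x T \<delta> (k + i))) (x (exit_time x T \<delta> k)) \<le> real i * \<delta>"
proof (induction i)
  case (Suc i)
  show ?case
    using dist_exit_time[of "k + i" "exit_time x T \<delta> (Suc (k + i))"] exit_time_mono[of "k + i" "Suc (k + i)"] Suc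
      dist_triangle[of "x (exit_time x T \<delta> (k + Suc i))" "x (exit_time x T \<delta> k)" "x (exit_time x T \<delta> (k + i))"]
    by (simp add: algebra_simps)
qed simp

end

subsection \<open>Exit times as stopping times\<close>

text \<open>Time ranges over all reals here. The process on \<open>{0..T}\<close> is fitted in later
  by clamping time to that interval.\<close>

locale continuous_process = filtration \<Omega> F
  for \<Omega> :: "'a set" and F :: "real \<Rightarrow> 'a measure" +
  fixes X :: "real \<Rightarrow> 'a \<Rightarrow> 'b::{metric_space, second_countable_topology}"
  assumes adapted: "X t \<in> borel_measurable (F t)"
    and continuous: "\<omega> \<in> \<Omega> \<Longrightarrow> continuous_on UNIV (\<lambda>t. X t \<omega>)"
begin

lemma measurable_F_mono: "s \<le> t \<Longrightarrow> f \<in> measurable (F s) N \<Longrightarrow> f \<in> measurable (F t) N"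
  by (rule measurable_from_subalg[of _ "F s"]) (simp_all add: subalgebra_def space_F sets_F_mono)

text \<open>Round the random time down to multiples of \<open>1 / real (Suc n)\<close>. The rounded
  time has countably many values, so sampling there is measurable, and path continuity gives the
  limit. The minimum with \<open>t\<close> keeps every sampled variable
  \<open>F t\<close>-measurable.\<close>

lemma measurable_at_random_time:
  assumes \<sigma>[measurable]: "\<sigma> \<in> borel_measurable (F t)" and le: "\<And>\<omega>. \<omega> \<in> \<Omega> \<Longrightarrow> \<sigma> \<omega> \<le> t"
  shows "(\<lambda>\<omega>. X (\<sigma> \<omega>) \<omega>) \<in> borel_measurable (F t)"
proof (rule borel_measurable_LIMSEQ_metric)
  let ?s = "\<lambda>n \<omega>. of_int \<lfloor>\<sigma> \<omega> * real (Suc n)\<rfloor> / real (Suc n)"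
  fix n
  have "(\<lambda>\<omega>. X (min t (of_int i / real (Suc n))) \<omega>) \<in> borel_measurable (F t)" for i :: int
    by (rule measurable_F_mono[OF _ adapted]) simp
  moreover have "(\<lambda>\<omega>. \<lfloor>\<sigma> \<omega> * real (Suc n)\<rfloor>) \<in> measurable (F t) (count_space UNIV)"
    by measurable
  ultimately show "(\<lambda>\<omega>. X (min t (?s n \<omega>)) \<omega>) \<in> borel_measurable (F t)"
    by (rule measurable_compose_countable)
next
  fix \<omega> assume "\<omega> \<in> space (F t)"
  then have \<omega>: "\<omega> \<in> \<Omega>" by (simp add: space_F)
  let ?s = "\<lambda>n. of_int \<lfloor>\<sigma> \<omega> * real (Suc n)\<rfloor> / real (Suc n)"
  have "?s \<longlonglongrightarrow> \<sigma> \<omega>"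
  proof (rule tendsto_sandwich)
    show "\<forall>\<^sub>F n in sequentially. \<sigma> \<omega> - 1 / real (Suc n) \<le> ?s n"
    proof (intro always_eventually allI)
      fix n
      have "\<sigma> \<omega> * real (Suc n) - 1 \<le> of_int \<lfloor>\<sigma> \<omega> * real (Suc n)\<rfloor>"
        using real_of_int_floor_gt_diff_one[of "\<sigma> \<omega> * real (Suc n)"] by (rule less_imp_le)
      then have "(\<sigma> \<omega> * real (Suc n) - 1) / real (Suc n) \<le> ?s n"
        by (rule divide_right_mono) (rule of_nat_0_le_iff)
      moreover have "(\<sigma> \<omega> * real (Suc n) - 1) / real (Suc n) = \<sigma> \<omega> - 1 / real (Suc n)"
        unfolding diff_divide_distrib by simp
      ultimately show "\<sigma> \<omega> - 1 / real (Suc n) \<le> ?s n"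
        by (simp only:)
    qed
    show "\<forall>\<^sub>F n in sequentially. ?s n \<le> \<sigma> \<omega>"
      by (intro always_eventually allI) (subst pos_divide_le_eq, simp_all only: of_nat_0_less_iff zero_less_Suc of_int_floor_le)
    show "(\<lambda>n. \<sigma> \<omega> - 1 / real (Suc n)) \<longlonglongrightarrow> \<sigma> \<omega>"
      by real_asymp
  qed simp
  then have "(\<lambda>n. min t (?s n)) \<longlonglongrightarrow> min t (\<sigma> \<omega>)"
    by (intro tendsto_min tendsto_const)
  moreover have "isCont (\<lambda>t. X t \<omega>) (min t (\<sigma> \<omega>))"
    using continuous[OF \<omega>] unfolding continuous_on_eq_continuous_at[OF open_UNIV] by blast
  ultimately have "(\<lambda>n. X (min t (?s n)) \<omega>) \<longlonglongrightarrow> X (min t (\<sigma> \<omega>)) \<omega>"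
    by (intro isCont_tendsto_compose[of "min t (\<sigma> \<omega>)" "\<lambda>t. X t \<omega>"])
  then show "(\<lambda>n. X (min t (?s n)) \<omega>) \<longlonglongrightarrow> X (\<sigma> \<omega>) \<omega>"
    unfolding min_absorb2[OF le[OF \<omega>]] .
qed

lemma measurable_stopping_time_min:
  assumes "stopping_time F \<sigma>"
  shows "(\<lambda>\<omega>. min (\<sigma> \<omega>) t) \<in> borel_measurable (F t)"
proof (rule borel_measurableI_le)
  fix y
  show "{\<omega> \<in> space (F t). min (\<sigma> \<omega>) t \<le> y} \<in> sets (F t)"
  proof (cases "t \<le> y")
    case False
    then show ?thesis
      using stopping_time_le_const[OF assms, of y t] by (simp add: pred_def min_le_iff_disj)
  qed (simp add: min_le_iff_disj)
qed

lemma measurable_at_stopping_time: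
  assumes "stopping_time F \<sigma>"
  shows "(\<lambda>\<omega>. X (\<sigma> \<omega>) \<omega>) \<in> borel_measurable (pre_sigma \<sigma>)"
proof (rule borel_measurableI)
  fix U :: "'b set" assume "open U"
  then have [measurable]: "U \<in> sets borel" by simp
  show "(\<lambda>\<omega>. X (\<sigma> \<omega>) \<omega>) -` U \<inter> space (pre_sigma \<sigma>) \<in> sets (pre_sigma \<sigma>)"
  proof (rule sets_pre_sigmaI[OF assms])
    fix t
    \<comment> \<open>Where \<open>\<sigma> \<omega> \<le> t\<close>, capping the time at
      \<open>t\<close> changes nothing, and the capped time is covered by
      \<open>measurable_at_random_time\<close>.\<close>
    have [measurable]: "(\<lambda>\<omega>. X (min (\<sigma> \<omega>) t) \<omega>) \<in> borel_measurable (F t)"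
      by (intro measurable_at_random_time measurable_stopping_time_min assms) simp
    have [measurable]: "Measurable.pred (F t) (\<lambda>\<omega>. \<sigma> \<omega> \<le> t)"
      using assms by (rule stopping_timeD)
    have "{\<omega> \<in> space (F t). X (min (\<sigma> \<omega>) t) \<omega> \<in> U \<and> \<sigma> \<omega> \<le> t} \<in> sets (F t)"
      by measurable
    also have "{\<omega> \<in> space (F t). X (min (\<sigma> \<omega>) t) \<omega> \<in> U \<and> \<sigma> \<omega> \<le> t} =
      {\<omega> \<in> (\<lambda>\<omega>. X (\<sigma> \<omega>) \<omega>) -` U \<inter> space (pre_sigma \<sigma>). \<sigma> \<omega> \<le> t}"
      by (auto simp: space_F space_pre_sigma min_absorb1)
    finally show "{\<omega> \<in> (\<lambda>\<omega>. X (\<sigma> \<omega>) \<omega>) -` U \<inter> space (pre_sigma \<sigma>). \<sigma> \<omega> \<le> t} \<in> sets (F t)" .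
  qed
qed

text \<open>The exit criterion runs over an uncountable, random set of times. Clamping replaces it
  by the fixed interval \<open>{0..t}\<close>. Lowering the threshold slightly then allows
  \<open>v\<close> to range over a countable dense set, and compactness recovers the exact
  threshold.\<close>

lemma stopping_time_next_exit:
  assumes \<sigma>: "stopping_time F \<sigma>" and \<sigma>_T: "\<And>\<omega>. \<omega> \<in> \<Omega> \<Longrightarrow> 0 \<le> \<sigma> \<omega> \<and> \<sigma> \<omega> \<le> T" and \<delta>: "0 < \<delta>"
  shows "stopping_time F (\<lambda>\<omega>. next_exit (\<lambda>t. X t \<omega>) T \<delta> (\<sigma> \<omega>))"
proof
  fix t
  show "Measurable.pred (F t) (\<lambda>\<omega>. next_exit (\<lambda>t. X t \<omega>) T \<delta> (\<sigma> \<omega>) \<le> t)"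
  proof (cases "t < T")
    case True
    obtain D where D: "countable D" "D \<subseteq> {0..t}" "{0..t} \<subseteq> closure D"
      using separable[of "{0..t}"] by blast
    \<comment> \<open>Both times are at most \<open>t\<close> for \<open>v \<le> t\<close>, which
      makes \<open>?g v\<close> measurable at \<open>t\<close>. If
      \<open>\<sigma> \<omega> > t\<close> they coincide, so the distance is 0 and no false exit is
      reported.\<close>
    let ?g = "\<lambda>v \<omega>. dist (X (max (min (\<sigma> \<omega>) t) v) \<omega>) (X (min (\<sigma> \<omega>) t) \<omega>)"
    have iff: "next_exit (\<lambda>t. X t \<omega>) T \<delta> (\<sigma> \<omega>) \<le> t \<longleftrightarrow> (\<forall>n. \<exists>v\<in>D. \<delta> - inverse (real (Suc n)) < ?g v \<omega>)"
      if "\<omega> \<in> space (F t)" for \<omega>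
    proof -
      have \<omega>: "\<omega> \<in> \<Omega>" using that by (simp add: space_F)
      have cont: "continuous_on A (\<lambda>v. ?g v \<omega>)" for A
        by (intro continuous_intros continuous_on_compose2[OF continuous[OF \<omega>]]) auto
      have "next_exit (\<lambda>t. X t \<omega>) T \<delta> (\<sigma> \<omega>) \<le> t \<longleftrightarrow> (\<exists>u\<in>{\<sigma> \<omega>..t}. \<delta> \<le> dist (X u \<omega>) (X (\<sigma> \<omega>) \<omega>))"
        using next_exit_le_iff[OF continuous[OF \<omega>]] \<sigma>_T[OF \<omega>] True by simp
      also have "\<dots> \<longleftrightarrow> (\<exists>v\<in>{0..t}. \<delta> \<le> ?g v \<omega>)"
      proof
        assume "\<exists>u\<in>{\<sigma> \<omega>..t}. \<delta> \<le> dist (X u \<omega>) (X (\<sigma> \<omega>) \<omega>)"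
        then obtain u where "u \<in> {\<sigma> \<omega>..t}" "\<delta> \<le> dist (X u \<omega>) (X (\<sigma> \<omega>) \<omega>)" ..
        with \<sigma>_T[OF \<omega>] show "\<exists>v\<in>{0..t}. \<delta> \<le> ?g v \<omega>"
          by (intro bexI[of _ u]) auto
      next
        assume "\<exists>v\<in>{0..t}. \<delta> \<le> ?g v \<omega>"
        then obtain v where v: "v \<in> {0..t}" "\<delta> \<le> ?g v \<omega>" ..
        have "\<sigma> \<omega> \<le> t"
        proof (rule ccontr)
          assume "\<not> \<sigma> \<omega> \<le> t"
          with v have "max (min (\<sigma> \<omega>) t) v = min (\<sigma> \<omega>) t" by auto
          with v(2) \<delta> show False by simp
        qed
        with v show "\<exists>u\<in>{\<sigma> \<omega>..t}. \<delta> \<le> dist (X u \<omega>) (X (\<sigma> \<omega>) \<omega>)"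
          by (intro bexI[of _ "max (\<sigma> \<omega>) v"]) auto
      qed
      also have "\<dots> \<longleftrightarrow> (\<forall>n. \<exists>v\<in>D. \<delta> - inverse (real (Suc n)) < ?g v \<omega>)"
      proof
        assume "\<exists>v\<in>{0..t}. \<delta> \<le> ?g v \<omega>"
        then obtain v where v: "v \<in> {0..t}" "\<delta> \<le> ?g v \<omega>" ..
        show "\<forall>n. \<exists>v\<in>D. \<delta> - inverse (real (Suc n)) < ?g v \<omega>"
        proof
          fix n
          have "open {v. \<delta> - inverse (real (Suc n)) < ?g v \<omega>}"
            by (rule open_Collect_less[OF continuous_on_const cont])
          moreover have "v \<in> {v. \<delta> - inverse (real (Suc n)) < ?g v \<omega>}"
            using less_le_trans[OF _ v(2), of "\<delta> - inverse (real (Suc n))"] by simp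
          moreover have "v \<in> closure D"
            using v(1) D(3) by auto
          ultimately have "{v. \<delta> - inverse (real (Suc n)) < ?g v \<omega>} \<inter> D \<noteq> {}"
            using open_Int_closure_eq_empty by blast
          then show "\<exists>v\<in>D. \<delta> - inverse (real (Suc n)) < ?g v \<omega>"
            by blast
        qed
      next
        assume *: "\<forall>n. \<exists>v\<in>D. \<delta> - inverse (real (Suc n)) < ?g v \<omega>"
        with D(2) have "{0..t} \<noteq> {}" by blast
        then obtain v where v: "v \<in> {0..t}" and max: "\<And>u. u \<in> {0..t} \<Longrightarrow> ?g u \<omega> \<le> ?g v \<omega>"
          using continuous_attains_sup[OF compact_Icc _ cont] by blast
        have "\<delta> - inverse (real (Suc n)) \<le> ?g v \<omega>" for n
        proof -
          obtain u where "u \<in> D" "\<delta> - inverse (real (Suc n)) < ?g u \<omega>"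
            using * by blast
          with D(2) max[of u] show ?thesis by (auto intro: less_imp_le less_le_trans)
        qed
        moreover have "(\<lambda>n. \<delta> - inverse (real (Suc n))) \<longlonglongrightarrow> \<delta> - 0"
          by (intro tendsto_diff tendsto_const LIMSEQ_inverse_real_of_nat)
        ultimately have "\<delta> \<le> ?g v \<omega>"
          by (intro LIMSEQ_le_const2[of _ \<delta>]) auto
        with v show "\<exists>v\<in>{0..t}. \<delta> \<le> ?g v \<omega>" ..
      qed
      finally show ?thesis .
    qed
    have [measurable]: "(\<lambda>\<omega>. X (max (min (\<sigma> \<omega>) t) v) \<omega>) \<in> borel_measurable (F t)" if "v \<in> D" for v
      using that D(2) measurable_stopping_time_min[OF \<sigma>, of t]
      by (intro measurable_at_random_time) auto
    have [measurable]: "(\<lambda>\<omega>. X (min (\<sigma> \<omega>) t) \<omega>) \<in> borel_measurable (F t)"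
      using measurable_stopping_time_min[OF \<sigma>, of t] by (intro measurable_at_random_time) auto
    have "Measurable.pred (F t) (\<lambda>\<omega>. \<forall>n. \<exists>v\<in>D. \<delta> - inverse (real (Suc n)) < ?g v \<omega>)"
      by (intro pred_intros_countable(1) measurable_pred_countable(2) D(1)) measurable
    with iff show ?thesis
      by (rule measurable_cong[THEN iffD2])
  next
    case False
    have "next_exit (\<lambda>t. X t \<omega>) T \<delta> (\<sigma> \<omega>) \<le> t" if "\<omega> \<in> space (F t)" for \<omega>
      using next_exit_le[OF continuous, of \<omega> "\<sigma> \<omega>" T \<delta>] \<sigma>_T that False by (simp add: space_F)
    then show ?thesis
      by (intro measurable_cong[THEN iffD2, OF _ measurable_const[of True]]) simp_all
  qed
qed

lemma stopping_time_exit_time: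
  assumes "0 < T" "0 < \<delta>"
  shows "stopping_time F (\<lambda>\<omega>. exit_time (\<lambda>t. X t \<omega>) T \<delta> k)"
proof (induction k)
  case (Suc k)
  then have "stopping_time F (\<lambda>\<omega>. next_exit (\<lambda>t. X t \<omega>) T \<delta> (exit_time (\<lambda>t. X t \<omega>) T \<delta> k))"
    by (rule stopping_time_next_exit)
      (simp_all add: assms continuous exit_time_le[OF _ assms] exit_time_nonneg[OF _ assms])
  then show ?case by simp
qed (simp add: stopping_time_const)

end

subsection \<open>The equivalent measure\<close>

text \<open>The assumption \<open>sticky\<close> is positivity of a conditional probability in
  contrapositive form: a set known at \<open>q\<close> on which the path almost surely moves away is
  null. In this form it passes to stopping times by covering a set with countably many null
  sets.\<close>

locale sticky_process = prob_space P + continuous_process "space P" F X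
  for P :: "'a measure" and F :: "real \<Rightarrow> 'a measure"
    and X :: "real \<Rightarrow> 'a \<Rightarrow> 'b::{metric_space, second_countable_topology}" +
  fixes T :: real
  assumes sets_F: "sets (F t) \<subseteq> sets P" and T: "0 < T"
    and sticky: "\<lbrakk>0 \<le> q; q < T; 0 < \<epsilon>; A \<in> sets (F q);
      AE \<omega> in P. \<omega> \<in> A \<longrightarrow> (\<exists>u\<in>{q..T}. \<epsilon> \<le> dist (X u \<omega>) (X q \<omega>))\<rbrakk> \<Longrightarrow> A \<in> null_sets P"
begin

section \<open>Stickiness at stopping times\<close>

lemma subalgebra_pre_sigma:
  assumes "stopping_time F \<sigma>" "\<And>\<omega>. \<omega> \<in> space P \<Longrightarrow> \<sigma> \<omega> \<le> T"
  shows "subalgebra P (pre_sigma \<sigma>)"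
  unfolding subalgebra_def
proof
  show "space (pre_sigma \<sigma>) = space P"
    by (rule space_pre_sigma)
  show "sets (pre_sigma \<sigma>) \<subseteq> sets P"
  proof
    fix A assume A: "A \<in> sets (pre_sigma \<sigma>)"
    then have "{\<omega> \<in> A. \<sigma> \<omega> \<le> T} = A"
      using sets.sets_into_space[OF A] assms(2) by (auto simp: space_pre_sigma)
    with sets_pre_sigmaD[OF assms(1) A, of T] sets_F[of T] show "A \<in> sets P"
      by auto
  qed
qed

text \<open>Between \<sigma> and the first move by \<open>\<delta> / 3\<close> lies a rational time
  \<open>q\<close>. There the path is still within \<open>\<delta> / 3\<close> of its value at
  \<sigma>, so a displacement by \<delta> must come after \<open>q\<close> and is at least
  \<open>\<delta> / 3\<close> as seen from \<open>q\<close>. Stickiness at \<open>q\<close> makes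
  each \<open>B q\<close> null, and these countably many sets cover \<open>A\<close>.\<close>

lemma sticky_stopping_time:
  assumes \<sigma>: "stopping_time F \<sigma>" and \<sigma>_T: "\<And>\<omega>. \<omega> \<in> space P \<Longrightarrow> 0 \<le> \<sigma> \<omega> \<and> \<sigma> \<omega> \<le> T" and \<delta>: "0 < \<delta>"
    and A: "A \<in> sets (pre_sigma \<sigma>)" "\<And>\<omega>. \<omega> \<in> A \<Longrightarrow> \<sigma> \<omega> < T"
    and AE: "AE \<omega> in P. \<omega> \<in> A \<longrightarrow> (\<exists>u\<in>{\<sigma> \<omega>..T}. \<delta> \<le> dist (X u \<omega>) (X (\<sigma> \<omega>) \<omega>))"
  shows "A \<in> null_sets P"
proof -
  let ?\<rho> = "\<lambda>\<omega>. next_exit (\<lambda>t. X t \<omega>) T (\<delta> / 3) (\<sigma> \<omega>)"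
  define B where "B q = {\<omega> \<in> A. \<sigma> \<omega> \<le> q \<and> q < ?\<rho> \<omega>}" for q
  have A_space: "A \<subseteq> space P"
    using sets.sets_into_space[OF A(1)] by (simp add: space_pre_sigma)
  have "B q \<in> null_sets P" if q: "q \<in> \<rat> \<inter> {0..<T}" for q
  proof (rule sticky)
    show "0 \<le> q" "q < T" "0 < \<delta> / 3" using q \<delta> by auto
    have "Measurable.pred (F q) (\<lambda>\<omega>. q < ?\<rho> \<omega>)"
      using \<delta> \<sigma>_T by (intro stopping_timeD2 stopping_time_next_exit \<sigma>) auto
    then have "{\<omega> \<in> A. \<sigma> \<omega> \<le> q} \<inter> {\<omega> \<in> space (F q). q < ?\<rho> \<omega>} \<in> sets (F q)"
      using sets_pre_sigmaD[OF \<sigma> A(1), of q] by (auto simp: pred_def)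
    also have "{\<omega> \<in> A. \<sigma> \<omega> \<le> q} \<inter> {\<omega> \<in> space (F q). q < ?\<rho> \<omega>} = B q"
      using A_space by (auto simp: B_def space_F)
    finally show "B q \<in> sets (F q)" .
    show "AE \<omega> in P. \<omega> \<in> B q \<longrightarrow> (\<exists>u\<in>{q..T}. \<delta> / 3 \<le> dist (X u \<omega>) (X q \<omega>))"
      using AE
    proof eventually_elim
      case (elim \<omega>)
      show ?case
      proof
        assume \<omega>: "\<omega> \<in> B q"
        then have \<omega>': "\<omega> \<in> space P" "\<omega> \<in> A" "\<sigma> \<omega> \<le> q" "q < ?\<rho> \<omega>"
          using A_space by (auto simp: B_def)
        have before: "dist (X u \<omega>) (X (\<sigma> \<omega>) \<omega>) < \<delta> / 3" if "\<sigma> \<omega> \<le> u" "u \<le> q" for u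
          using dist_before_next_exit[OF continuous, of \<omega> "\<sigma> \<omega>" T u "\<delta> / 3"] \<omega>' \<sigma>_T that by simp
        obtain u where u: "u \<in> {\<sigma> \<omega>..T}" "\<delta> \<le> dist (X u \<omega>) (X (\<sigma> \<omega>) \<omega>)"
          using elim \<omega>' by auto
        have "q < u"
          using before[of u] u \<delta> by force
        moreover have "\<delta> / 3 \<le> dist (X u \<omega>) (X q \<omega>)"
          using before[of q] \<omega>' u(2) dist_triangle[of "X u \<omega>" "X (\<sigma> \<omega>) \<omega>" "X q \<omega>"] \<delta> by simp
        ultimately show "\<exists>u\<in>{q..T}. \<delta> / 3 \<le> dist (X u \<omega>) (X q \<omega>)"
          using u(1) by (intro bexI[of _ u]) auto
      qed
    qed
  qed
  then have "(\<Union>q\<in>\<rat> \<inter> {0..<T}. B q) \<in> null_sets P"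
    by (intro null_sets_UN') (auto intro: countable_rat countable_Int1)
  also have "(\<Union>q\<in>\<rat> \<inter> {0..<T}. B q) = A"
  proof
    show "(\<Union>q\<in>\<rat> \<inter> {0..<T}. B q) \<subseteq> A" by (auto simp: B_def)
    show "A \<subseteq> (\<Union>q\<in>\<rat> \<inter> {0..<T}. B q)"
    proof
      fix \<omega> assume \<omega>: "\<omega> \<in> A"
      then have \<omega>': "\<omega> \<in> space P" "0 \<le> \<sigma> \<omega>" "\<sigma> \<omega> < T" using A_space A(2) \<sigma>_T by auto
      then have "\<sigma> \<omega> < ?\<rho> \<omega>"
        using next_exit_gt[OF continuous, of \<omega> "\<sigma> \<omega>" T "\<delta> / 3"] \<delta> by simp
      then obtain q where "q \<in> \<rat>" "\<sigma> \<omega> < q" "q < ?\<rho> \<omega>"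
        using Rats_dense_in_real by blast
      moreover have "?\<rho> \<omega> \<le> T"
        using next_exit_le[OF continuous, of \<omega> "\<sigma> \<omega>" T] \<omega>' by simp
      ultimately show "\<omega> \<in> (\<Union>q\<in>\<rat> \<inter> {0..<T}. B q)"
        using \<omega> \<omega>' by (auto simp: B_def intro!: bexI[of _ q])
    qed
  qed
  finally show ?thesis .
qed

end

section \<open>The density and its integrals over the events of a given exit count\<close>

locale exit_density = sticky_process P F X T
  for P :: "'a measure" and F :: "real \<Rightarrow> 'a measure"
    and X :: "real \<Rightarrow> 'a \<Rightarrow> 'b::{metric_space, second_countable_topology}" and T :: real +
  fixes \<delta> :: real and w :: "'a \<Rightarrow> ennreal"
  assumes \<delta>: "0 < \<delta>"
    and measurable_w: "w \<in> borel_measurable (F 0)" and w: "0 < w \<omega>" "w \<omega> \<le> 1"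
begin

definition \<tau> :: "nat \<Rightarrow> 'a \<Rightarrow> real" where
  "\<tau> k \<omega> = exit_time (\<lambda>t. X t \<omega>) T \<delta> k"

abbreviation G :: "nat \<Rightarrow> 'a measure" where
  "G k \<equiv> pre_sigma (\<tau> k)"

text \<open>An exit falling exactly at \<open>T\<close> is not counted. This is harmless, since the
  path still stays within the closed \<delta>-ball around its value at \<open>\<tau> k\<close> up to
  and including \<open>T\<close>.\<close>

definition E :: "nat \<Rightarrow> 'a set" where
  "E k = {\<omega> \<in> space P. \<tau> k \<omega> < T \<and> \<tau> (Suc k) \<omega> = T}"

text \<open>With values in \<open>ennreal\<close> the inverse is defined everywhere, equal to
  \<open>top\<close> where \<open>p k\<close> vanishes. Up to a null set this happens only where
  \<open>\<tau> k = T\<close>.\<close>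

definition p :: "nat \<Rightarrow> 'a \<Rightarrow> ennreal" where
  "p k = nn_cond_exp P (G k) (indicator (E k))"

text \<open>The value of \<open>\<eta>\<close> makes the series of \<open>(exp \<delta> * \<eta>) ^ i\<close> sum to exactly \<open>exp \<delta>\<close>.\<close>

definition \<eta> :: real where
  "\<eta> = exp (- \<delta>) * (1 - exp (- \<delta>))"

text \<open>The events \<open>E k\<close> partition the space, so at most one summand is nonzero at
  each point. Normalisation is left to \<open>Q\<close>.\<close>

definition Z :: "'a \<Rightarrow> ennreal" where
  "Z \<omega> = (\<Sum>k. w \<omega> * ennreal (\<eta> ^ k) * indicator (E k) \<omega> * inverse (p k \<omega>))"

lemma \<eta>: "0 < \<eta>" and \<eta>_exp: "exp \<delta> * \<eta> = 1 - exp (- \<delta>)" and \<eta>_le: "\<eta> \<le> 1 - exp (- \<delta>)"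
proof -
  have *: "0 < 1 - exp (- \<delta>)" "exp (- \<delta>) \<le> 1" using \<delta> by simp_all
  then show "0 < \<eta>" by (simp add: \<eta>_def)
  show "exp \<delta> * \<eta> = 1 - exp (- \<delta>)"
    by (simp add: \<eta>_def mult.assoc[symmetric] exp_minus)
  show "\<eta> \<le> 1 - exp (- \<delta>)"
    unfolding \<eta>_def using * by (intro mult_left_le_one_le) simp_all
qed

lemma stopping_time_\<tau>: "stopping_time F (\<tau> k)"
  unfolding \<tau>_def using T \<delta> by (rule stopping_time_exit_time)

lemma
  assumes "\<omega> \<in> space P"
  shows \<tau>_le: "\<tau> k \<omega> \<le> T" and \<tau>_nonneg: "0 \<le> \<tau> k \<omega>" and \<tau>_mono: "j \<le> k \<Longrightarrow> \<tau> j \<omega> \<le> \<tau> k \<omega>"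
  unfolding \<tau>_def
  by (rule exit_time_le[OF continuous[OF assms] T \<delta>] exit_time_nonneg[OF continuous[OF assms] T \<delta>]
    exit_time_mono[OF continuous[OF assms] T \<delta>], assumption?)+

lemma \<tau>_0 [simp]: "\<tau> 0 = (\<lambda>\<omega>. 0)"
  by (simp add: \<tau>_def fun_eq_iff)

lemma space_G [simp]: "space (G k) = space P"
  by (rule space_pre_sigma)

lemma subalgebra_G: "subalgebra P (G k)"
  by (intro subalgebra_pre_sigma stopping_time_\<tau> \<tau>_le)

lemma measurable_G_P: "f \<in> measurable (G k) N \<Longrightarrow> f \<in> measurable P N"
  using subalgebra_G by (rule measurable_from_subalg)

lemma measurable_G_mono: "j \<le> k \<Longrightarrow> f \<in> measurable (G j) N \<Longrightarrow> f \<in> measurable (G k) N"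
  by (rule measurable_from_subalg[of _ "G j"])
    (simp_all add: subalgebra_def mono_pre_sigma[OF stopping_time_\<tau> stopping_time_\<tau> \<tau>_mono])

lemma cond_exp_G: "sigma_finite_subalgebra P (G k)"
  by (intro finite_measure_subalgebra_is_sigma_finite finite_measure_subalgebra.intro
      finite_measure_subalgebra_axioms.intro subalgebra_G) unfold_locales

lemma measurable_\<tau> [measurable]: "\<tau> k \<in> borel_measurable P"
  using measurable_stopping_time_pre_sigma[OF stopping_time_\<tau>] by (rule measurable_G_P)

lemma pred_\<tau>_less [measurable]: "Measurable.pred (G k) (\<lambda>\<omega>. \<tau> k \<omega> < T)"
  using measurable_stopping_time_pre_sigma[OF stopping_time_\<tau>, of k] by measurable

lemma sets_E [measurable]: "E k \<in> sets P"
  unfolding E_def by measurable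

lemma measurable_p [measurable]: "p k \<in> borel_measurable (G k)" "p k \<in> borel_measurable P"
  unfolding p_def by auto

text \<open>As \<open>\<tau> k\<close> is nonnegative, what is known at time 0 is known at
  \<open>\<tau> k\<close>. This lets the weight \<open>w\<close> enter conditional integrals at
  every exit.\<close>

lemma subalgebra_G_F0: "subalgebra (G k) (F 0)"
  unfolding subalgebra_def
proof (intro conjI subsetI)
  show "space (F 0) = space (G k)"
    by (simp add: space_F)
  fix A assume A: "A \<in> sets (F 0)"
  then have A_space: "A \<subseteq> space P"
    using sets.sets_into_space space_F by blast
  show "A \<in> sets (G k)"
  proof (rule sets_pre_sigmaI[OF stopping_time_\<tau>])
    fix t
    show "{\<omega> \<in> A. \<tau> k \<omega> \<le> t} \<in> sets (F t)"
    proof (cases "0 \<le> t")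
      case True
      then have "A \<in> sets (F t)"
        using A sets_F_mono by blast
      then have "A \<inter> {\<omega> \<in> space (F t). \<tau> k \<omega> \<le> t} \<in> sets (F t)"
        using stopping_timeD[OF stopping_time_\<tau>] unfolding pred_def by (rule sets.Int)
      also have "A \<inter> {\<omega> \<in> space (F t). \<tau> k \<omega> \<le> t} = {\<omega> \<in> A. \<tau> k \<omega> \<le> t}"
        using A_space unfolding space_F by blast
      finally show ?thesis .
    next
      case False
      then have "{\<omega> \<in> A. \<tau> k \<omega> \<le> t} = {}"
        using A_space \<tau>_nonneg[of _ k] by (auto dest!: subsetD dest: order_trans)
      then show ?thesis by (simp only: sets.empty_sets)
    qed
  qed
qed

lemma measurable_w_G: "w \<in> borel_measurable (G k)"
  using subalgebra_G_F0 measurable_w by (rule measurable_from_subalg)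

lemma measurable_w_P [measurable]: "w \<in> borel_measurable P"
  using measurable_w_G by (rule measurable_G_P)

lemma measurable_Z [measurable]: "Z \<in> borel_measurable P"
  unfolding Z_def
  by (intro borel_measurable_suminf_order borel_measurable_times_ennreal borel_measurable_inverse_ennreal
      measurable_w_P measurable_p borel_measurable_const borel_measurable_indicator sets_E)

lemma ex1_E: "\<omega> \<in> space P \<Longrightarrow> \<exists>!k. \<omega> \<in> E k"
  using exit_time_unique_last[OF continuous T \<delta>, of \<omega>] by (simp add: E_def \<tau>_def)

lemma Z_eq:
  assumes "\<omega> \<in> E k"
  shows "Z \<omega> = w \<omega> * ennreal (\<eta> ^ k) * inverse (p k \<omega>)"
proof -
  have "\<omega> \<in> space P" using assms by (auto simp: E_def)
  from ex1_E[OF this] assms have *: "\<omega> \<in> E j \<longleftrightarrow> j = k" for j by blast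
  have "Z \<omega> = (\<Sum>j\<in>{k}. w \<omega> * ennreal (\<eta> ^ j) * indicator (E j) \<omega> * inverse (p j \<omega>))"
    unfolding Z_def by (rule suminf_finite) (auto simp: *)
  with assms show ?thesis by simp
qed

lemma AE_p_finite: "AE \<omega> in P. p k \<omega> \<noteq> \<infinity>"
proof (rule nn_integral_PInf_AE)
  interpret sigma_finite_subalgebra P "G k" by (rule cond_exp_G)
  have "(\<integral>\<^sup>+ \<omega>. 1 * p k \<omega> \<partial>P) = (\<integral>\<^sup>+ \<omega>. 1 * indicator (E k) \<omega> \<partial>P)"
    unfolding p_def by (rule nn_cond_exp_intg) auto
  then show "(\<integral>\<^sup>+ \<omega>. p k \<omega> \<partial>P) \<noteq> \<infinity>"
    by (simp add: emeasure_eq_measure)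
qed auto

text \<open>On the set \<open>A\<close> where this fails, \<open>E k\<close> has no mass. Almost
  every path in \<open>A\<close> therefore moves by \<delta> after \<open>\<tau> k\<close>, and
  stickiness at this stopping time makes \<open>A\<close> null.\<close>

lemma AE_p_pos: "AE \<omega> in P. \<tau> k \<omega> < T \<longrightarrow> p k \<omega> \<noteq> 0"
proof -
  interpret sigma_finite_subalgebra P "G k" by (rule cond_exp_G)
  define A where "A = {\<omega> \<in> space (G k). p k \<omega> = 0 \<and> \<tau> k \<omega> < T}"
  have A: "A \<in> sets (G k)"
    unfolding A_def by measurable
  then have A_P: "A \<in> sets P"
    using subalgebra_G by (auto simp: subalgebra_def)
  have "(\<integral>\<^sup>+ \<omega>. indicator A \<omega> * indicator (E k) \<omega> \<partial>P) = (\<integral>\<^sup>+ \<omega>. indicator A \<omega> * p k \<omega> \<partial>P)"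
    unfolding p_def by (rule nn_cond_exp_intg[symmetric]) (use A in auto)
  also have "\<dots> = (\<integral>\<^sup>+ \<omega>. 0 \<partial>P)"
    by (intro nn_integral_cong) (auto simp: A_def indicator_def)
  finally have AE: "AE \<omega> in P. indicator A \<omega> * indicator (E k) \<omega> = (0::ennreal)"
    using A_P by (simp add: nn_integral_0_iff_AE)
  have "A \<in> null_sets P"
  proof (rule sticky_stopping_time[OF stopping_time_\<tau> _ \<delta> A])
    show "0 \<le> \<tau> k \<omega> \<and> \<tau> k \<omega> \<le> T" if "\<omega> \<in> space P" for \<omega>
      using that \<tau>_nonneg \<tau>_le by auto
    show "\<tau> k \<omega> < T" if "\<omega> \<in> A" for \<omega>
      using that by (simp add: A_def)
    show "AE \<omega> in P. \<omega> \<in> A \<longrightarrow> (\<exists>u\<in>{\<tau> k \<omega>..T}. \<delta> \<le> dist (X u \<omega>) (X (\<tau> k \<omega>) \<omega>))"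
      using AE AE_space
    proof eventually_elim
      case (elim \<omega>)
      show ?case
      proof (rule impI, rule ccontr)
        assume \<omega>: "\<omega> \<in> A" "\<not> (\<exists>u\<in>{\<tau> k \<omega>..T}. \<delta> \<le> dist (X u \<omega>) (X (\<tau> k \<omega>) \<omega>))"
        then have "\<tau> (Suc k) \<omega> = T"
          using next_exit_eq_T[OF continuous, of \<omega> "\<tau> k \<omega>" T \<delta>] elim(2) \<tau>_le[of \<omega> k]
          by (simp add: not_le \<tau>_def)
        with \<omega>(1) elim show False
          by (auto simp: A_def E_def split: split_indicator_asm)
      qed
    qed
  qed
  then show ?thesis
    using A_P by (intro AE_I[of _ _ A]) (auto simp: A_def)
qed

lemma AE_Z: "AE \<omega> in P. 0 < Z \<omega> \<and> Z \<omega> < \<infinity>"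
proof -
  have "AE \<omega> in P. \<forall>k. p k \<omega> \<noteq> \<infinity> \<and> (\<tau> k \<omega> < T \<longrightarrow> p k \<omega> \<noteq> 0)"
    unfolding AE_all_countable using AE_p_finite AE_p_pos by auto
  with AE_space show ?thesis
  proof eventually_elim
    case (elim \<omega>)
    then obtain k where k: "\<omega> \<in> E k" using ex1_E by blast
    then have "p k \<omega> \<noteq> \<infinity>" "p k \<omega> \<noteq> 0"
      using elim by (auto simp: E_def)
    then have "0 < inverse (p k \<omega>)" "inverse (p k \<omega>) < top"
      by (simp_all add: ennreal_inverse_positive less_top[symmetric])
    moreover have "w \<omega> < top"
      using w(2)[of \<omega>] by (rule le_less_trans) simp
    moreover have "0 < ennreal (\<eta> ^ k)"
      using \<eta> by simp
    ultimately show ?case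
      using w(1)[of \<omega>] unfolding Z_eq[OF k] infinity_ennreal_def
      by (simp add: ennreal_mult_less_top ennreal_zero_less_mult_iff)
  qed
qed

text \<open>The density is chosen so that restricting to the event of no further exit after the
  \<open>k\<close>-th one merely contributes the factor \<open>\<eta> ^ k\<close>.\<close>

lemma nn_integral_Z_E:
  assumes f: "f \<in> borel_measurable (G k)"
  shows "(\<integral>\<^sup>+ \<omega>. Z \<omega> * f \<omega> * indicator (E k) \<omega> \<partial>P) =
    ennreal (\<eta> ^ k) * (\<integral>\<^sup>+ \<omega>. w \<omega> * f \<omega> * indicator {..<T} (\<tau> k \<omega>) \<partial>P)"
proof -
  interpret sigma_finite_subalgebra P "G k" by (rule cond_exp_G)
  have \<tau>_G: "\<tau> k \<in> borel_measurable (G k)"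
    by (intro measurable_stopping_time_pre_sigma stopping_time_\<tau>)
  \<comment> \<open>The indicator confines the integrand to \<open>\<tau> k < T\<close>, where
    \<open>p k\<close> is almost surely nonzero and finite and hence cancels. Elsewhere both sides
    are 0.\<close>
  let ?h = "\<lambda>\<omega>. w \<omega> * f \<omega> * indicator {..<T} (\<tau> k \<omega>)"
  have h: "?h \<in> borel_measurable (G k)"
    by (intro borel_measurable_times_ennreal measurable_w_G f measurable_compose[OF \<tau>_G] borel_measurable_indicator)
      simp
  have h_p: "(\<lambda>\<omega>. ?h \<omega> * inverse (p k \<omega>)) \<in> borel_measurable (G k)"
    by (intro borel_measurable_times_ennreal[OF h] borel_measurable_inverse_ennreal measurable_p)
  have "(\<integral>\<^sup>+ \<omega>. Z \<omega> * f \<omega> * indicator (E k) \<omega> \<partial>P) =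
      (\<integral>\<^sup>+ \<omega>. ennreal (\<eta> ^ k) * ((?h \<omega> * inverse (p k \<omega>)) * indicator (E k) \<omega>) \<partial>P)"
  proof (intro nn_integral_cong)
    fix \<omega>
    show "Z \<omega> * f \<omega> * indicator (E k) \<omega> = ennreal (\<eta> ^ k) * ((?h \<omega> * inverse (p k \<omega>)) * indicator (E k) \<omega>)"
    proof (cases "\<omega> \<in> E k")
      case True
      then have "\<tau> k \<omega> < T" by (simp add: E_def)
      with True show ?thesis by (simp add: Z_eq[OF True] mult_ac)
    qed simp
  qed
  also have "\<dots> = ennreal (\<eta> ^ k) * (\<integral>\<^sup>+ \<omega>. (?h \<omega> * inverse (p k \<omega>)) * indicator (E k) \<omega> \<partial>P)"
    by (intro nn_integral_cmult borel_measurable_times_ennreal measurable_G_P[OF h_p] borel_measurable_indicator sets_E)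
  \<comment> \<open>The factor \<open>?h \<omega> * inverse (p k \<omega>)\<close> is known at
    \<open>\<tau> k\<close>, so the indicator of \<open>E k\<close> may be replaced by its
    conditional expectation \<open>p k\<close>.\<close>
  also have "(\<integral>\<^sup>+ \<omega>. (?h \<omega> * inverse (p k \<omega>)) * indicator (E k) \<omega> \<partial>P) =
      (\<integral>\<^sup>+ \<omega>. (?h \<omega> * inverse (p k \<omega>)) * p k \<omega> \<partial>P)"
    by (rule nn_cond_exp_intg[symmetric, OF h_p, of "indicator (E k)", folded p_def]) simp
  also have "\<dots> = (\<integral>\<^sup>+ \<omega>. ?h \<omega> \<partial>P)"
  proof (rule nn_integral_cong_AE)
    show "AE \<omega> in P. (?h \<omega> * inverse (p k \<omega>)) * p k \<omega> = ?h \<omega>"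
      using AE_p_pos[of k] AE_p_finite[of k]
    proof eventually_elim
      case (elim \<omega>)
      show ?case
      proof (cases "\<tau> k \<omega> < T")
        case True
        with elim have "p k \<omega> / p k \<omega> = 1"
          by (intro ennreal_divide_self) (simp_all add: less_top)
        then have "inverse (p k \<omega>) * p k \<omega> = 1"
          by (simp only: divide_ennreal_def mult.commute)
        then show ?thesis by (simp only: mult.assoc mult_1_right)
      qed simp
    qed
  qed
  finally show ?thesis .
qed

text \<open>Split by the number \<open>i\<close> of further exits. As \<open>f\<close> and
  \<open>C\<close> are known at \<open>\<tau> k\<close>, they are known at
  \<open>\<tau> (k + i)\<close>, where \<open>nn_integral_Z_E\<close> applies. Dropping the
  condition \<open>\<tau> (k + i) \<omega> < T\<close> leaves the same integral for every
  \<open>i\<close>, so that it factors out of the series.\<close>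

lemma nn_integral_Z_le:
  assumes f: "f \<in> borel_measurable (G k)" and g: "g \<in> borel_measurable P"
    and C: "C \<in> sets (G k)" "\<And>\<omega>. \<omega> \<in> C \<Longrightarrow> \<tau> k \<omega> < T"
    and le: "\<And>i \<omega>. \<omega> \<in> C \<Longrightarrow> \<omega> \<in> E (k + i) \<Longrightarrow> g \<omega> \<le> b i * f \<omega>"
  shows "(\<integral>\<^sup>+ \<omega>. Z \<omega> * g \<omega> * indicator C \<omega> \<partial>P) \<le>
    (\<Sum>i. b i * ennreal (\<eta> ^ i)) * (ennreal (\<eta> ^ k) * (\<integral>\<^sup>+ \<omega>. w \<omega> * f \<omega> * indicator C \<omega> \<partial>P))"
proof -
  have C_P: "C \<in> sets P"
    using C(1) subalgebra_G by (auto simp: subalgebra_def)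
  have f_P: "f \<in> borel_measurable P"
    using f by (rule measurable_G_P)
  let ?I = "\<integral>\<^sup>+ \<omega>. w \<omega> * f \<omega> * indicator C \<omega> \<partial>P"
  have "(\<integral>\<^sup>+ \<omega>. Z \<omega> * g \<omega> * indicator C \<omega> \<partial>P) =
      (\<integral>\<^sup>+ \<omega>. (\<Sum>i. Z \<omega> * g \<omega> * indicator C \<omega> * indicator (E (k + i)) \<omega>) \<partial>P)"
  proof (rule nn_integral_cong)
    fix \<omega> assume "\<omega> \<in> space P"
    from ex1_E[OF this] obtain j where j: "\<omega> \<in> E j" and j': "\<And>i. \<omega> \<in> E i \<Longrightarrow> i = j" by blast
    show "Z \<omega> * g \<omega> * indicator C \<omega> = (\<Sum>i. Z \<omega> * g \<omega> * indicator C \<omega> * indicator (E (k + i)) \<omega>)"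
    proof (cases "\<omega> \<in> C")
      case True
      have "k \<le> j"
      proof (rule ccontr)
        assume "\<not> k \<le> j"
        then have "\<tau> (Suc j) \<omega> \<le> \<tau> k \<omega>"
          using \<open>\<omega> \<in> space P\<close> by (intro \<tau>_mono) auto
        with C(2)[OF True] j show False by (simp add: E_def)
      qed
      have "(\<Sum>i. Z \<omega> * g \<omega> * indicator C \<omega> * indicator (E (k + i)) \<omega>) =
        (\<Sum>i\<in>{j - k}. Z \<omega> * g \<omega> * indicator C \<omega> * indicator (E (k + i)) \<omega>)"
      proof (rule suminf_finite)
        fix i assume "i \<notin> {j - k}"
        then have "\<omega> \<notin> E (k + i)" using j'[of "k + i"] by auto
        then show "Z \<omega> * g \<omega> * indicator C \<omega> * indicator (E (k + i)) \<omega> = 0" by simp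
      qed simp
      with j \<open>k \<le> j\<close> show ?thesis by simp
    qed simp
  qed
  also have "\<dots> = (\<Sum>i. \<integral>\<^sup>+ \<omega>. Z \<omega> * g \<omega> * indicator C \<omega> * indicator (E (k + i)) \<omega> \<partial>P)"
    by (intro nn_integral_suminf borel_measurable_times_ennreal measurable_Z g borel_measurable_indicator C_P sets_E)
  also have "\<dots> \<le> (\<Sum>i. b i * ennreal (\<eta> ^ i) * (ennreal (\<eta> ^ k) * ?I))"
  proof (rule suminf_le)
    fix i
    let ?J = "\<integral>\<^sup>+ \<omega>. Z \<omega> * (f \<omega> * indicator C \<omega>) * indicator (E (k + i)) \<omega> \<partial>P"
    have "?J = ennreal (\<eta> ^ (k + i)) * (\<integral>\<^sup>+ \<omega>. w \<omega> * (f \<omega> * indicator C \<omega>) * indicator {..<T} (\<tau> (k + i) \<omega>) \<partial>P)"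
      by (rule nn_integral_Z_E, rule measurable_G_mono[of k])
        (simp, intro borel_measurable_times_ennreal f borel_measurable_indicator C)
    also have "\<dots> \<le> ennreal (\<eta> ^ (k + i)) * ?I"
      by (intro mult_left_mono nn_integral_mono) (simp_all add: indicator_def)
    also have "ennreal (\<eta> ^ (k + i)) = ennreal (\<eta> ^ i) * ennreal (\<eta> ^ k)"
      using \<eta> by (subst ennreal_mult[symmetric]) (simp_all add: power_add mult.commute)
    finally have J: "?J \<le> ennreal (\<eta> ^ i) * ennreal (\<eta> ^ k) * ?I" .
    have "(\<integral>\<^sup>+ \<omega>. Z \<omega> * g \<omega> * indicator C \<omega> * indicator (E (k + i)) \<omega> \<partial>P) \<le>
        (\<integral>\<^sup>+ \<omega>. b i * (Z \<omega> * (f \<omega> * indicator C \<omega>) * indicator (E (k + i)) \<omega>) \<partial>P)"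
    proof (rule nn_integral_mono)
      fix \<omega>
      show "Z \<omega> * g \<omega> * indicator C \<omega> * indicator (E (k + i)) \<omega> \<le>
          b i * (Z \<omega> * (f \<omega> * indicator C \<omega>) * indicator (E (k + i)) \<omega>)"
      proof (cases "\<omega> \<in> C \<and> \<omega> \<in> E (k + i)")
        case True
        then have "Z \<omega> * g \<omega> \<le> Z \<omega> * (b i * f \<omega>)"
          by (intro mult_left_mono le) simp_all
        with True show ?thesis by (simp add: mult.left_commute)
      qed auto
    qed
    also have "\<dots> = b i * ?J"
      by (intro nn_integral_cmult borel_measurable_times_ennreal measurable_Z f_P borel_measurable_indicator C_P sets_E)
    also have "\<dots> \<le> b i * (ennreal (\<eta> ^ i) * ennreal (\<eta> ^ k) * ?I)"
      by (rule mult_left_mono[OF J]) simp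
    also have "\<dots> = b i * ennreal (\<eta> ^ i) * (ennreal (\<eta> ^ k) * ?I)"
      by (simp only: mult.assoc)
    finally show "(\<integral>\<^sup>+ \<omega>. Z \<omega> * g \<omega> * indicator C \<omega> * indicator (E (k + i)) \<omega> \<partial>P) \<le>
        b i * ennreal (\<eta> ^ i) * (ennreal (\<eta> ^ k) * ?I)" .
  qed simp_all
  also have "\<dots> = (\<Sum>i. b i * ennreal (\<eta> ^ i)) * (ennreal (\<eta> ^ k) * ?I)"
    by (rule ennreal_suminf_multc)
  finally show ?thesis .
qed

text \<open>For a lower bound the single piece without further exits suffices, so no series
  appears.\<close>

lemma nn_integral_Z_ge:
  assumes f: "f \<in> borel_measurable (G k)"
    and C: "C \<in> sets (G k)" "\<And>\<omega>. \<omega> \<in> C \<Longrightarrow> \<tau> k \<omega> < T"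
    and le: "\<And>\<omega>. \<omega> \<in> C \<Longrightarrow> \<omega> \<in> E k \<Longrightarrow> b * f \<omega> \<le> g \<omega>"
  shows "b * (ennreal (\<eta> ^ k) * (\<integral>\<^sup>+ \<omega>. w \<omega> * f \<omega> * indicator C \<omega> \<partial>P)) \<le>
    (\<integral>\<^sup>+ \<omega>. Z \<omega> * g \<omega> * indicator C \<omega> \<partial>P)"
proof -
  have C_P: "C \<in> sets P"
    using C(1) subalgebra_G by (auto simp: subalgebra_def)
  have f_P: "f \<in> borel_measurable P"
    using f by (rule measurable_G_P)
  have "(\<integral>\<^sup>+ \<omega>. w \<omega> * f \<omega> * indicator C \<omega> \<partial>P) =
      (\<integral>\<^sup>+ \<omega>. w \<omega> * (f \<omega> * indicator C \<omega>) * indicator {..<T} (\<tau> k \<omega>) \<partial>P)"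
    by (intro nn_integral_cong) (auto simp: indicator_def C(2))
  also have "ennreal (\<eta> ^ k) * \<dots> = (\<integral>\<^sup>+ \<omega>. Z \<omega> * (f \<omega> * indicator C \<omega>) * indicator (E k) \<omega> \<partial>P)"
    by (intro nn_integral_Z_E[symmetric] borel_measurable_times_ennreal f borel_measurable_indicator C)
  also have "b * \<dots> = (\<integral>\<^sup>+ \<omega>. b * (Z \<omega> * (f \<omega> * indicator C \<omega>) * indicator (E k) \<omega>) \<partial>P)"
    by (intro nn_integral_cmult[symmetric] borel_measurable_times_ennreal measurable_Z f_P borel_measurable_indicator C_P sets_E)
  also have "\<dots> \<le> (\<integral>\<^sup>+ \<omega>. Z \<omega> * g \<omega> * indicator C \<omega> \<partial>P)"
  proof (rule nn_integral_mono)
    fix \<omega>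
    show "b * (Z \<omega> * (f \<omega> * indicator C \<omega>) * indicator (E k) \<omega>) \<le> Z \<omega> * g \<omega> * indicator C \<omega>"
    proof (cases "\<omega> \<in> C \<and> \<omega> \<in> E k")
      case True
      then have "Z \<omega> * (b * f \<omega>) \<le> Z \<omega> * g \<omega>"
        by (intro mult_left_mono le) simp_all
      with True show ?thesis by (simp add: mult.left_commute)
    qed auto
  qed
  finally show ?thesis .
qed

text \<open>The weights are 1 when the integrand does not change with further exits, as for the
  total mass or a price at \<open>\<tau> k\<close>. The bound
  \<open>1 / (1 - \<eta>) \<le> exp \<delta>\<close> restates \<open>\<eta>_le\<close>.\<close>

lemma suminf_\<eta>: "(\<Sum>i. 1 * ennreal (\<eta> ^ i)) \<le> ennreal (exp \<delta>)"
proof -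
  have \<eta>_less: "\<eta> < 1"
    using \<eta>_le exp_gt_zero[of "- \<delta>"] by linarith
  have pos: "0 \<le> \<eta> ^ i" for i
    using \<eta> by simp
  have "(\<lambda>i. \<eta> ^ i) sums (1 / (1 - \<eta>))"
    using \<eta> \<eta>_less by (intro geometric_sums) simp
  from suminf_ennreal_eq[OF pos this] have "(\<Sum>i. 1 * ennreal (\<eta> ^ i)) = ennreal (1 / (1 - \<eta>))"
    by (simp only: mult_1_left)
  also have "1 / (1 - \<eta>) \<le> exp \<delta>"
  proof -
    have "1 / (1 - \<eta>) \<le> 1 / exp (- \<delta>)"
      using \<eta>_le \<eta>_less by (intro divide_left_mono mult_pos_pos) simp_all
    also have "1 / exp (- \<delta>) = exp \<delta>"
      by (simp only: exp_minus inverse_eq_divide[symmetric] inverse_inverse_eq)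
    finally show ?thesis .
  qed
  then have "ennreal (1 / (1 - \<eta>)) \<le> ennreal (exp \<delta>)"
    by (rule ennreal_leI)
  finally show ?thesis .
qed

text \<open>After \<open>i\<close> further exits and the last stretch up to \<open>T\<close>, the
  logarithm has moved by at most \<open>real (Suc i) * \<delta>\<close>; this is the origin of the
  weights. One \<open>exp \<delta>\<close> factors out, and the remaining geometric series
  contributes the other.\<close>

lemma suminf_exp_\<eta>: "(\<Sum>i. ennreal (exp (real (Suc i) * \<delta>)) * ennreal (\<eta> ^ i)) = ennreal (exp (2 * \<delta>))"
proof -
  have "(\<lambda>i. exp \<delta> * (exp \<delta> * \<eta>) ^ i) sums (exp \<delta> * (1 / (1 - exp \<delta> * \<eta>)))"
    using \<delta> by (intro sums_mult geometric_sums) (simp add: \<eta>_exp)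
  moreover have "exp \<delta> * (1 / (1 - exp \<delta> * \<eta>)) = exp (2 * \<delta>)"
  proof -
    have "1 / (1 - exp \<delta> * \<eta>) = exp \<delta>"
      unfolding \<eta>_exp by (simp only: diff_diff_eq2 add_diff_cancel_left' exp_minus inverse_eq_divide[symmetric] inverse_inverse_eq)
    then show ?thesis by (simp only: exp_add mult_2)
  qed
  ultimately have "(\<lambda>i. exp \<delta> * (exp \<delta> * \<eta>) ^ i) sums exp (2 * \<delta>)"
    by (simp only:)
  moreover have "0 \<le> exp \<delta> * (exp \<delta> * \<eta>) ^ i" for i
    using \<eta> by simp
  ultimately have sum: "(\<Sum>i. ennreal (exp \<delta> * (exp \<delta> * \<eta>) ^ i)) = ennreal (exp (2 * \<delta>))"
    by (intro suminf_ennreal_eq)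
  have "exp (real (Suc i) * \<delta>) * \<eta> ^ i = exp \<delta> * (exp \<delta> * \<eta>) ^ i" for i
    unfolding exp_of_nat_mult power_mult_distrib power_Suc by (simp only: mult.assoc)
  then have "ennreal (exp (real (Suc i) * \<delta>)) * ennreal (\<eta> ^ i) = ennreal (exp \<delta> * (exp \<delta> * \<eta>) ^ i)" for i
    using \<eta> by (subst ennreal_mult[symmetric]) simp_all
  then show ?thesis
    unfolding sum[symmetric] by (intro arg_cong[of _ _ suminf] ext)
qed

lemma nn_integral_Z: "(\<integral>\<^sup>+ \<omega>. Z \<omega> \<partial>P) \<le> ennreal (exp \<delta>)"
proof -
  have top: "space P \<in> sets (G 0)"
    using sets.top[of "G 0"] by (simp only: space_G)
  have "(\<integral>\<^sup>+ \<omega>. Z \<omega> * 1 * indicator (space P) \<omega> \<partial>P) \<le>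
      (\<Sum>i. 1 * ennreal (\<eta> ^ i)) * (ennreal (\<eta> ^ 0) * (\<integral>\<^sup>+ \<omega>. w \<omega> * 1 * indicator (space P) \<omega> \<partial>P))"
    by (rule nn_integral_Z_le) (use T top in simp_all)
  also have "\<dots> \<le> ennreal (exp \<delta>) * (ennreal (\<eta> ^ 0) * 1)"
  proof (intro mult_mono suminf_\<eta>)
    have "(\<integral>\<^sup>+ \<omega>. w \<omega> * 1 * indicator (space P) \<omega> \<partial>P) \<le> (\<integral>\<^sup>+ \<omega>. 1 \<partial>P)"
      using w(2) by (intro nn_integral_mono) (simp add: indicator_def)
    then show "(\<integral>\<^sup>+ \<omega>. w \<omega> * 1 * indicator (space P) \<omega> \<partial>P) \<le> 1"
      by (simp add: emeasure_space_1)
  qed simp_all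
  also have "(\<integral>\<^sup>+ \<omega>. Z \<omega> * 1 * indicator (space P) \<omega> \<partial>P) = (\<integral>\<^sup>+ \<omega>. Z \<omega> \<partial>P)"
    by (intro nn_integral_cong) simp
  finally show ?thesis by simp
qed

section \<open>Comparing prices at a fixed time with prices at \<open>T\<close>\<close>

lemma measurable_F_P: "f \<in> measurable (F t) N \<Longrightarrow> f \<in> measurable P N"
  by (rule measurable_from_subalg[of _ "F t"]) (simp_all add: subalgebra_def space_F sets_F)

text \<open>The function \<phi> stands for the exponential of one coordinate, which recovers a price
  from its logarithm. The last assumption says that distances of logarithms bound ratios of
  prices.\<close>

context
  fixes \<phi> :: "'b \<Rightarrow> real"
  assumes measurable_\<phi>: "\<phi> \<in> borel_measurable borel"
    and \<phi>_nonneg: "0 \<le> \<phi> x"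
    and \<phi>_exp: "\<phi> x \<le> exp (dist x y) * \<phi> y"
begin

lemma \<phi>_le:
  assumes "dist x y \<le> r"
  shows "ennreal (\<phi> x) \<le> ennreal (exp r) * ennreal (\<phi> y)"
proof -
  have "\<phi> x \<le> exp r * \<phi> y"
    using \<phi>_exp[of x y] mult_right_mono[of "exp (dist x y)" "exp r" "\<phi> y"] assms \<phi>_nonneg[of y] by simp
  then show ?thesis
    by (subst ennreal_mult[symmetric]) (simp_all add: \<phi>_nonneg ennreal_leI)
qed

lemma measurable_\<phi>_X: "(\<lambda>\<omega>. \<phi> (X t \<omega>)) \<in> borel_measurable (F t)"
  by (intro measurable_compose[OF adapted measurable_\<phi>])

lemma measurable_\<phi>_X_P: "(\<lambda>\<omega>. ennreal (\<phi> (X t \<omega>))) \<in> borel_measurable P"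
  by (intro measurable_compose[OF measurable_F_P[OF measurable_\<phi>_X] measurable_ennreal])

lemma measurable_\<phi>_\<tau>: "(\<lambda>\<omega>. ennreal (\<phi> (X (\<tau> k \<omega>) \<omega>))) \<in> borel_measurable (G k)"
  by (intro measurable_compose[OF measurable_compose[OF measurable_at_stopping_time[OF stopping_time_\<tau>]
        measurable_\<phi>] measurable_ennreal])

lemma dist_\<tau>:
  assumes "\<omega> \<in> space P" "\<tau> k \<omega> \<le> u" "u \<le> \<tau> (Suc k) \<omega>"
  shows "dist (X u \<omega>) (X (\<tau> k \<omega>) \<omega>) \<le> \<delta>"
  using dist_exit_time[OF continuous[OF assms(1)] T \<delta>] assms(2,3) unfolding \<tau>_def by blast

lemma \<phi>_T_le:
  assumes "\<omega> \<in> E (k + i)"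
  shows "ennreal (\<phi> (X T \<omega>)) \<le> ennreal (exp (real (Suc i) * \<delta>)) * ennreal (\<phi> (X (\<tau> k \<omega>) \<omega>))"
proof (rule \<phi>_le)
  have "\<omega> \<in> space P" "\<tau> (k + Suc i) \<omega> = T"
    using assms by (auto simp: E_def)
  then show "dist (X T \<omega>) (X (\<tau> k \<omega>) \<omega>) \<le> real (Suc i) * \<delta>"
    using dist_exit_times[OF continuous T \<delta>, of \<omega> k "Suc i"] unfolding \<tau>_def by simp
qed

lemma \<phi>_\<tau>_le:
  assumes "\<omega> \<in> E k"
  shows "ennreal (exp (- \<delta>)) * ennreal (\<phi> (X (\<tau> k \<omega>) \<omega>)) \<le> ennreal (\<phi> (X T \<omega>))"
proof -
  have *: "\<omega> \<in> space P" "\<tau> (Suc k) \<omega> = T"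
    using assms by (auto simp: E_def)
  have "dist (X (\<tau> k \<omega>) \<omega>) (X T \<omega>) \<le> \<delta>"
    using dist_\<tau>[of \<omega> k T] * \<tau>_le[of \<omega> k] by (simp add: dist_commute)
  then have "ennreal (exp (- \<delta>)) * ennreal (\<phi> (X (\<tau> k \<omega>) \<omega>)) \<le>
      ennreal (exp (- \<delta>)) * (ennreal (exp \<delta>) * ennreal (\<phi> (X T \<omega>)))"
    by (intro mult_left_mono \<phi>_le) simp_all
  also have "\<dots> = ennreal (exp (- \<delta>) * exp \<delta>) * ennreal (\<phi> (X T \<omega>))"
    by (simp add: ennreal_mult mult.assoc)
  also have "\<dots> = ennreal (\<phi> (X T \<omega>))"
    by (simp add: exp_minus)
  finally show ?thesis .
qed

text \<open>This is the series estimate at \<open>\<tau> 0\<close>, where the weight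
  \<open>w\<close> compensates for an initial price that may fail to be integrable.\<close>

lemma nn_integral_Z_\<phi>_finite:
  assumes "\<And>\<omega>. \<omega> \<in> space P \<Longrightarrow> w \<omega> * ennreal (\<phi> (X 0 \<omega>)) \<le> 1"
  shows "(\<integral>\<^sup>+ \<omega>. Z \<omega> * ennreal (\<phi> (X T \<omega>)) \<partial>P) \<le> ennreal (exp (2 * \<delta>))"
proof -
  have top: "space P \<in> sets (G 0)"
    using sets.top[of "G 0"] by (simp only: space_G)
  have "(\<integral>\<^sup>+ \<omega>. Z \<omega> * ennreal (\<phi> (X T \<omega>)) * indicator (space P) \<omega> \<partial>P) \<le>
      (\<Sum>i. ennreal (exp (real (Suc i) * \<delta>)) * ennreal (\<eta> ^ i)) *
      (ennreal (\<eta> ^ 0) * (\<integral>\<^sup>+ \<omega>. w \<omega> * ennreal (\<phi> (X (\<tau> 0 \<omega>) \<omega>)) * indicator (space P) \<omega> \<partial>P))"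
    by (rule nn_integral_Z_le[OF measurable_\<phi>_\<tau> measurable_\<phi>_X_P top _ \<phi>_T_le]) (simp_all add: T)
  also have "\<dots> \<le> ennreal (exp (2 * \<delta>)) * (ennreal (\<eta> ^ 0) * 1)"
    unfolding suminf_exp_\<eta>
  proof (intro mult_mono)
    have "(\<integral>\<^sup>+ \<omega>. w \<omega> * ennreal (\<phi> (X (\<tau> 0 \<omega>) \<omega>)) * indicator (space P) \<omega> \<partial>P) \<le> (\<integral>\<^sup>+ \<omega>. 1 \<partial>P)"
      using assms by (intro nn_integral_mono) simp
    then show "(\<integral>\<^sup>+ \<omega>. w \<omega> * ennreal (\<phi> (X (\<tau> 0 \<omega>) \<omega>)) * indicator (space P) \<omega> \<partial>P) \<le> 1"
      by (simp add: emeasure_space_1)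
  qed simp_all
  also have "(\<integral>\<^sup>+ \<omega>. Z \<omega> * ennreal (\<phi> (X T \<omega>)) * indicator (space P) \<omega> \<partial>P) =
      (\<integral>\<^sup>+ \<omega>. Z \<omega> * ennreal (\<phi> (X T \<omega>)) \<partial>P)"
    by (intro nn_integral_cong) simp
  finally show ?thesis by simp
qed

text \<open>Both integrals are compared with \<open>?I\<close>: the upper bounds come from the two
  series, the lower bounds from the paths without further exits.\<close>

lemma nn_integral_\<phi>_\<tau>:
  assumes C: "C \<in> sets (G k)" "\<And>\<omega>. \<omega> \<in> C \<Longrightarrow> \<tau> k \<omega> < T"
  shows "(\<integral>\<^sup>+ \<omega>. Z \<omega> * ennreal (\<phi> (X T \<omega>)) * indicator C \<omega> \<partial>P) \<le>
      ennreal (exp (2 * \<delta>)) * (\<integral>\<^sup>+ \<omega>. Z \<omega> * ennreal (\<phi> (X (\<tau> k \<omega>) \<omega>)) * indicator C \<omega> \<partial>P)"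
    and "(\<integral>\<^sup>+ \<omega>. Z \<omega> * ennreal (\<phi> (X (\<tau> k \<omega>) \<omega>)) * indicator C \<omega> \<partial>P) \<le>
      ennreal (exp (2 * \<delta>)) * (\<integral>\<^sup>+ \<omega>. Z \<omega> * ennreal (\<phi> (X T \<omega>)) * indicator C \<omega> \<partial>P)"
proof -
  let ?I = "ennreal (\<eta> ^ k) * (\<integral>\<^sup>+ \<omega>. w \<omega> * ennreal (\<phi> (X (\<tau> k \<omega>) \<omega>)) * indicator C \<omega> \<partial>P)"
  let ?U = "\<integral>\<^sup>+ \<omega>. Z \<omega> * ennreal (\<phi> (X (\<tau> k \<omega>) \<omega>)) * indicator C \<omega> \<partial>P"
  let ?V = "\<integral>\<^sup>+ \<omega>. Z \<omega> * ennreal (\<phi> (X T \<omega>)) * indicator C \<omega> \<partial>P"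
  have "?V \<le> (\<Sum>i. ennreal (exp (real (Suc i) * \<delta>)) * ennreal (\<eta> ^ i)) * ?I"
    by (rule nn_integral_Z_le[OF measurable_\<phi>_\<tau> measurable_\<phi>_X_P C \<phi>_T_le])
  moreover have "1 * ?I \<le> ?U"
    by (rule nn_integral_Z_ge[OF measurable_\<phi>_\<tau> C]) simp_all
  ultimately show "?V \<le> ennreal (exp (2 * \<delta>)) * ?U"
    unfolding suminf_exp_\<eta> mult_1_left by (rule order_trans[OF _ mult_left_mono]) simp
  have "?U \<le> (\<Sum>i. 1 * ennreal (\<eta> ^ i)) * ?I"
    by (rule nn_integral_Z_le[OF measurable_\<phi>_\<tau> measurable_G_P[OF measurable_\<phi>_\<tau>] C]) simp_all
  also have "\<dots> \<le> ennreal (exp \<delta>) * ?I"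
    by (intro mult_right_mono suminf_\<eta>) simp
  \<comment> \<open>The factor \<open>exp (- \<delta>)\<close> is split off because it is the loss
    in \<open>\<phi>_\<tau>_le\<close> on the last stretch up to \<open>T\<close>.\<close>
  also have "\<dots> = ennreal (exp (2 * \<delta>)) * (ennreal (exp (- \<delta>)) * ?I)"
  proof -
    have "exp \<delta> = exp (2 * \<delta>) * exp (- \<delta>)"
      by (simp add: exp_add[symmetric])
    then show ?thesis
      by (simp only: ennreal_mult exp_ge_zero mult.assoc)
  qed
  also have "\<dots> \<le> ennreal (exp (2 * \<delta>)) * ?V"
    by (intro mult_left_mono nn_integral_Z_ge measurable_\<phi>_\<tau> C \<phi>_\<tau>_le) simp_all
  finally show "?U \<le> ennreal (exp (2 * \<delta>)) * ?V" .
qed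

lemma nn_integral_split_exits:
  assumes t: "0 \<le> t" "t < T" and A: "A \<in> sets P" and h: "h \<in> borel_measurable P"
  shows "(\<integral>\<^sup>+ \<omega>. h \<omega> * indicator A \<omega> \<partial>P) =
    (\<Sum>n. \<integral>\<^sup>+ \<omega>. h \<omega> * indicator {\<omega> \<in> A. \<tau> n \<omega> \<le> t \<and> t < \<tau> (Suc n) \<omega>} \<omega> \<partial>P)"
proof -
  have B: "{\<omega> \<in> A. \<tau> n \<omega> \<le> t \<and> t < \<tau> (Suc n) \<omega>} \<in> sets P" for n
  proof -
    have "{\<omega> \<in> space P. \<tau> n \<omega> \<le> t \<and> t < \<tau> (Suc n) \<omega>} \<in> sets P"
      by measurable
    with A have "A \<inter> {\<omega> \<in> space P. \<tau> n \<omega> \<le> t \<and> t < \<tau> (Suc n) \<omega>} \<in> sets P"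
      by (rule sets.Int)
    also have "A \<inter> {\<omega> \<in> space P. \<tau> n \<omega> \<le> t \<and> t < \<tau> (Suc n) \<omega>} = {\<omega> \<in> A. \<tau> n \<omega> \<le> t \<and> t < \<tau> (Suc n) \<omega>}"
      using sets.sets_into_space[OF A] by blast
    finally show ?thesis .
  qed
  have "(\<integral>\<^sup>+ \<omega>. h \<omega> * indicator A \<omega> \<partial>P) =
      (\<integral>\<^sup>+ \<omega>. (\<Sum>n. h \<omega> * indicator {\<omega> \<in> A. \<tau> n \<omega> \<le> t \<and> t < \<tau> (Suc n) \<omega>} \<omega>) \<partial>P)"
  proof (rule nn_integral_cong)
    fix \<omega> assume "\<omega> \<in> space P"
    then obtain n where n: "\<tau> n \<omega> \<le> t" "t < \<tau> (Suc n) \<omega>"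
      and n': "\<And>i. \<tau> i \<omega> \<le> t \<Longrightarrow> t < \<tau> (Suc i) \<omega> \<Longrightarrow> i = n"
      using exit_time_unique[OF continuous T \<delta> t] unfolding \<tau>_def by blast
    have "(\<Sum>n. h \<omega> * indicator {\<omega> \<in> A. \<tau> n \<omega> \<le> t \<and> t < \<tau> (Suc n) \<omega>} \<omega>) =
        (\<Sum>n\<in>{n}. h \<omega> * indicator {\<omega> \<in> A. \<tau> n \<omega> \<le> t \<and> t < \<tau> (Suc n) \<omega>} \<omega>)"
    proof (rule suminf_finite)
      fix i assume "i \<notin> {n}"
      then have "\<omega> \<notin> {\<omega> \<in> A. \<tau> i \<omega> \<le> t \<and> t < \<tau> (Suc i) \<omega>}" using n'[of i] by blast
      then show "h \<omega> * indicator {\<omega> \<in> A. \<tau> i \<omega> \<le> t \<and> t < \<tau> (Suc i) \<omega>} \<omega> = 0"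
        by (subst indicator_simps(2)) simp_all
    qed simp
    also have "\<dots> = h \<omega> * indicator A \<omega>"
      using n by (cases "\<omega> \<in> A") simp_all
    finally show "h \<omega> * indicator A \<omega> = (\<Sum>n. h \<omega> * indicator {\<omega> \<in> A. \<tau> n \<omega> \<le> t \<and> t < \<tau> (Suc n) \<omega>} \<omega>)" ..
  qed
  also have "\<dots> = (\<Sum>n. \<integral>\<^sup>+ \<omega>. h \<omega> * indicator {\<omega> \<in> A. \<tau> n \<omega> \<le> t \<and> t < \<tau> (Suc n) \<omega>} \<omega> \<partial>P)"
    by (intro nn_integral_suminf borel_measurable_times_ennreal h borel_measurable_indicator B)
  finally show ?thesis .
qed

text \<open>On \<open>C\<close> the next exit comes before \<open>T\<close>, and the comparison at
  that exit applies. On \<open>D\<close> the next exit time is \<open>T\<close> itself, and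
  closeness of the path values is enough.\<close>

lemma nn_integral_\<phi>_between_exits:
  assumes t: "0 \<le> t" "t < T" and A: "A \<in> sets (F t)"
    and B_def: "B = {\<omega> \<in> A. \<tau> n \<omega> \<le> t \<and> t < \<tau> (Suc n) \<omega>}"
  shows "(\<integral>\<^sup>+ \<omega>. Z \<omega> * ennreal (\<phi> (X T \<omega>)) * indicator B \<omega> \<partial>P) \<le>
      ennreal (exp (4 * \<delta>)) * (\<integral>\<^sup>+ \<omega>. Z \<omega> * ennreal (\<phi> (X t \<omega>)) * indicator B \<omega> \<partial>P)" (is "?V B \<le> _ * ?U B")
    and "(\<integral>\<^sup>+ \<omega>. Z \<omega> * ennreal (\<phi> (X t \<omega>)) * indicator B \<omega> \<partial>P) \<le>
      ennreal (exp (4 * \<delta>)) * (\<integral>\<^sup>+ \<omega>. Z \<omega> * ennreal (\<phi> (X T \<omega>)) * indicator B \<omega> \<partial>P)"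
proof -
  define C where "C = {\<omega> \<in> A. \<tau> n \<omega> \<le> t \<and> t < \<tau> (Suc n) \<omega> \<and> \<tau> (Suc n) \<omega> < T}"
  define D where "D = {\<omega> \<in> A. \<tau> n \<omega> \<le> t \<and> t < \<tau> (Suc n) \<omega> \<and> \<not> \<tau> (Suc n) \<omega> < T}"
  have A_space: "A \<subseteq> space P"
    using sets.sets_into_space[OF A] by (simp only: space_F)
  \<comment> \<open>Although \<open>A\<close> is known only at \<open>t\<close>, on \<open>C\<close>
    the time \<open>t\<close> has passed before \<open>\<tau> (Suc n)\<close>, so \<open>C\<close>
    belongs to the past of that exit.\<close>
  have C: "C \<in> sets (G (Suc n))"
  proof (rule sets_pre_sigmaI[OF stopping_time_\<tau>])
    fix s
    have meas: "A \<inter> {\<omega> \<in> space (F s). \<tau> n \<omega> \<le> t \<and> t < \<tau> (Suc n) \<omega> \<and> \<tau> (Suc n) \<omega> < T \<and> \<tau> (Suc n) \<omega> \<le> s} \<in> sets (F s)"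
      if "t \<le> s"
    proof (rule sets.Int)
      show "A \<in> sets (F s)"
        using A sets_F_mono[OF that] by blast
      \<comment> \<open>Distinguishing \<open>s < T\<close> leaves one comparison of the stopping
        time with a constant that is at most \<open>s\<close>.\<close>
      have *: "(\<tau> (Suc n) \<omega> < T \<and> \<tau> (Suc n) \<omega> \<le> s) = (if s < T then \<tau> (Suc n) \<omega> \<le> s else \<tau> (Suc n) \<omega> < T)" for \<omega>
        by auto
      have 1: "Measurable.pred (F s) (\<lambda>\<omega>. \<tau> (Suc n) \<omega> < T \<and> \<tau> (Suc n) \<omega> \<le> s)"
      proof (cases "s < T")
        case True
        then show ?thesis using stopping_timeD[OF stopping_time_\<tau>] unfolding * by (simp only: if_True)
      next
        case False
        then have "Measurable.pred (F s) (\<lambda>\<omega>. \<tau> (Suc n) \<omega> < T)"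
          using stopping_time_less_const[OF stopping_time_\<tau>[of "Suc n"], of T] by (intro measurable_F_mono[of T s]) simp_all
        with False show ?thesis unfolding * by (simp only: if_False)
      qed
      have 2: "Measurable.pred (F s) (\<lambda>\<omega>. \<tau> n \<omega> \<le> t)"
        using that by (intro stopping_time_le_const stopping_time_\<tau>)
      have 3: "Measurable.pred (F s) (\<lambda>\<omega>. \<not> \<tau> (Suc n) \<omega> \<le> t)"
        using that by (intro pred_intros_logic(2) stopping_time_le_const stopping_time_\<tau>)
      have "Measurable.pred (F s) (\<lambda>\<omega>. \<tau> n \<omega> \<le> t \<and> \<not> \<tau> (Suc n) \<omega> \<le> t \<and> \<tau> (Suc n) \<omega> < T \<and> \<tau> (Suc n) \<omega> \<le> s)"
        by (rule pred_intros_logic(3)[OF 2 pred_intros_logic(3)[OF 3 1]])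
      then show "{\<omega> \<in> space (F s). \<tau> n \<omega> \<le> t \<and> t < \<tau> (Suc n) \<omega> \<and> \<tau> (Suc n) \<omega> < T \<and> \<tau> (Suc n) \<omega> \<le> s} \<in> sets (F s)"
        unfolding pred_def not_le .
    qed
    show "{\<omega> \<in> C. \<tau> (Suc n) \<omega> \<le> s} \<in> sets (F s)"
    proof (cases "t \<le> s")
      case True
      have "{\<omega> \<in> C. \<tau> (Suc n) \<omega> \<le> s} =
          A \<inter> {\<omega> \<in> space (F s). \<tau> n \<omega> \<le> t \<and> t < \<tau> (Suc n) \<omega> \<and> \<tau> (Suc n) \<omega> < T \<and> \<tau> (Suc n) \<omega> \<le> s}"
        using A_space unfolding C_def space_F by blast
      with meas[OF True] show ?thesis by (simp only:)
    next
      case False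
      then have "{\<omega> \<in> C. \<tau> (Suc n) \<omega> \<le> s} = {}"
        unfolding C_def by auto
      then show ?thesis by (simp only: sets.empty_sets)
    qed
  qed
  have C_less: "\<tau> (Suc n) \<omega> < T" if "\<omega> \<in> C" for \<omega>
    using that by (simp add: C_def)
  have C_P: "C \<in> sets P"
    using C subalgebra_G unfolding subalgebra_def by blast
  have D_P: "D \<in> sets P"
  proof -
    have "A \<in> sets P" using A sets_F by blast
    moreover have "{\<omega> \<in> space P. \<tau> n \<omega> \<le> t \<and> t < \<tau> (Suc n) \<omega> \<and> \<not> \<tau> (Suc n) \<omega> < T} \<in> sets P"
      by measurable
    ultimately have "A \<inter> {\<omega> \<in> space P. \<tau> n \<omega> \<le> t \<and> t < \<tau> (Suc n) \<omega> \<and> \<not> \<tau> (Suc n) \<omega> < T} \<in> sets P"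
      by (rule sets.Int)
    also have "A \<inter> {\<omega> \<in> space P. \<tau> n \<omega> \<le> t \<and> t < \<tau> (Suc n) \<omega> \<and> \<not> \<tau> (Suc n) \<omega> < T} = D"
      using A_space unfolding D_def by blast
    finally show ?thesis .
  qed
  have split: "(\<integral>\<^sup>+ \<omega>. Z \<omega> * h \<omega> * indicator B \<omega> \<partial>P) =
      (\<integral>\<^sup>+ \<omega>. Z \<omega> * h \<omega> * indicator C \<omega> \<partial>P) + (\<integral>\<^sup>+ \<omega>. Z \<omega> * h \<omega> * indicator D \<omega> \<partial>P)"
    if h: "h \<in> borel_measurable P" for h
  proof -
    have "(\<integral>\<^sup>+ \<omega>. Z \<omega> * h \<omega> * indicator B \<omega> \<partial>P) =
        (\<integral>\<^sup>+ \<omega>. Z \<omega> * h \<omega> * indicator C \<omega> + Z \<omega> * h \<omega> * indicator D \<omega> \<partial>P)"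
      by (intro nn_integral_cong) (auto simp: B_def C_def D_def indicator_def)
    also have "\<dots> = (\<integral>\<^sup>+ \<omega>. Z \<omega> * h \<omega> * indicator C \<omega> \<partial>P) + (\<integral>\<^sup>+ \<omega>. Z \<omega> * h \<omega> * indicator D \<omega> \<partial>P)"
      by (intro nn_integral_add borel_measurable_times_ennreal measurable_Z h borel_measurable_indicator C_P D_P)
    finally show ?thesis .
  qed
  \<comment> \<open>The value at \<open>\<tau> n\<close> is the intermediate point, since
    \<open>t\<close> and the next exit time both lie in the closed interval between these
    exits.\<close>
  have dist_le: "dist (X u \<omega>) (X v \<omega>) \<le> 2 * \<delta>"
    if "\<omega> \<in> B" "u \<in> {t, \<tau> (Suc n) \<omega>}" "v \<in> {t, \<tau> (Suc n) \<omega>}" for \<omega> u v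
  proof -
    have *: "\<omega> \<in> space P" "\<tau> n \<omega> \<le> t" "t < \<tau> (Suc n) \<omega>"
      using that(1) A_space unfolding B_def by auto
    then have "\<tau> n \<omega> \<le> u" "u \<le> \<tau> (Suc n) \<omega>" "\<tau> n \<omega> \<le> v" "v \<le> \<tau> (Suc n) \<omega>"
      using that(2,3) by auto
    then have "dist (X u \<omega>) (X (\<tau> n \<omega>) \<omega>) \<le> \<delta>" "dist (X v \<omega>) (X (\<tau> n \<omega>) \<omega>) \<le> \<delta>"
      using dist_\<tau>[OF *(1)] by auto
    then show ?thesis
      using dist_triangle2[of "X u \<omega>" "X v \<omega>" "X (\<tau> n \<omega>) \<omega>"] by linarith
  qed
  have mono: "(\<integral>\<^sup>+ \<omega>. Z \<omega> * g \<omega> * indicator K \<omega> \<partial>P) \<le> c * (\<integral>\<^sup>+ \<omega>. Z \<omega> * h \<omega> * indicator K \<omega> \<partial>P)"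
    if "\<And>\<omega>. \<omega> \<in> K \<Longrightarrow> g \<omega> \<le> c * h \<omega>" "K \<in> sets P" "h \<in> borel_measurable P" for g h K c
  proof -
    have "(\<integral>\<^sup>+ \<omega>. Z \<omega> * g \<omega> * indicator K \<omega> \<partial>P) \<le> (\<integral>\<^sup>+ \<omega>. c * (Z \<omega> * h \<omega> * indicator K \<omega>) \<partial>P)"
    proof (rule nn_integral_mono)
      fix \<omega>
      show "Z \<omega> * g \<omega> * indicator K \<omega> \<le> c * (Z \<omega> * h \<omega> * indicator K \<omega>)"
      proof (cases "\<omega> \<in> K")
        case True
        then have "Z \<omega> * g \<omega> \<le> Z \<omega> * (c * h \<omega>)"
          by (intro mult_left_mono that(1)) simp_all
        with True show ?thesis by (simp add: mult.left_commute)
      qed simp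
    qed
    also have "\<dots> = c * (\<integral>\<^sup>+ \<omega>. Z \<omega> * h \<omega> * indicator K \<omega> \<partial>P)"
      by (intro nn_integral_cmult borel_measurable_times_ennreal measurable_Z that borel_measurable_indicator)
    finally show ?thesis .
  qed
  let ?W = "\<lambda>K. \<integral>\<^sup>+ \<omega>. Z \<omega> * ennreal (\<phi> (X (\<tau> (Suc n) \<omega>) \<omega>)) * indicator K \<omega> \<partial>P"
  \<comment> \<open>One factor pays for the comparison at the exit time, the other for the wait from
    \<open>t\<close> until then.\<close>
  have exp4: "ennreal (exp (4 * \<delta>)) = ennreal (exp (2 * \<delta>)) * ennreal (exp (2 * \<delta>))"
  proof -
    have "exp (4 * \<delta>) = exp (2 * \<delta>) * exp (2 * \<delta>)"
      unfolding exp_add[symmetric] by simp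
    then show ?thesis by (simp only: ennreal_mult exp_ge_zero)
  qed
  have exp24: "ennreal (exp (2 * \<delta>)) \<le> ennreal (exp (4 * \<delta>))"
    using \<delta> by (intro ennreal_leI) simp
  have sub: "\<omega> \<in> B" if "\<omega> \<in> C \<or> \<omega> \<in> D" for \<omega>
    using that unfolding B_def C_def D_def by blast
  have D_T: "\<tau> (Suc n) \<omega> = T" if "\<omega> \<in> D" for \<omega>
    using that \<tau>_le[of \<omega> "Suc n"] A_space unfolding D_def by force
  have "?V C \<le> ennreal (exp (2 * \<delta>)) * ?W C"
    by (rule nn_integral_\<phi>_\<tau>(1)[OF C C_less])
  also have "?W C \<le> ennreal (exp (2 * \<delta>)) * ?U C"
    by (intro mono \<phi>_le dist_le sub disjI1 C_P measurable_\<phi>_X_P) simp_all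
  finally have VC: "?V C \<le> ennreal (exp (4 * \<delta>)) * ?U C"
    unfolding exp4 mult.assoc by (simp add: mult_left_mono)
  have UW: "?U C \<le> ennreal (exp (2 * \<delta>)) * ?W C"
    by (intro mono \<phi>_le dist_le sub disjI1 C_P measurable_G_P[OF measurable_\<phi>_\<tau>]) simp_all
  have "ennreal (exp (2 * \<delta>)) * ?W C \<le> ennreal (exp (2 * \<delta>)) * (ennreal (exp (2 * \<delta>)) * ?V C)"
    by (intro mult_left_mono nn_integral_\<phi>_\<tau>(2)[OF C C_less]) simp_all
  with UW have UC: "?U C \<le> ennreal (exp (4 * \<delta>)) * ?V C"
    unfolding exp4 mult.assoc by (rule order_trans)
  have "?V D \<le> ennreal (exp (2 * \<delta>)) * ?U D"
    by (intro mono \<phi>_le dist_le sub disjI2 D_P measurable_\<phi>_X_P) (simp_all add: D_T)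
  also have "\<dots> \<le> ennreal (exp (4 * \<delta>)) * ?U D"
    by (intro mult_right_mono exp24) simp
  finally have VD: "?V D \<le> ennreal (exp (4 * \<delta>)) * ?U D" .
  have "?U D \<le> ennreal (exp (2 * \<delta>)) * ?V D"
    by (intro mono \<phi>_le dist_le sub disjI2 D_P measurable_\<phi>_X_P) (simp_all add: D_T)
  also have "\<dots> \<le> ennreal (exp (4 * \<delta>)) * ?V D"
    by (intro mult_right_mono exp24) simp
  finally have UD: "?U D \<le> ennreal (exp (4 * \<delta>)) * ?V D" .
  show "?V B \<le> ennreal (exp (4 * \<delta>)) * ?U B"
    unfolding split[OF measurable_\<phi>_X_P] distrib_left by (intro add_mono VC VD)
  show "?U B \<le> ennreal (exp (4 * \<delta>)) * ?V B"
    unfolding split[OF measurable_\<phi>_X_P] distrib_left by (intro add_mono UC UD)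
qed

lemma nn_integral_\<phi>_T:
  assumes t: "0 \<le> t" "t \<le> T" and A: "A \<in> sets (F t)"
  shows "(\<integral>\<^sup>+ \<omega>. Z \<omega> * ennreal (\<phi> (X T \<omega>)) * indicator A \<omega> \<partial>P) \<le>
      ennreal (exp (4 * \<delta>)) * (\<integral>\<^sup>+ \<omega>. Z \<omega> * ennreal (\<phi> (X t \<omega>)) * indicator A \<omega> \<partial>P)" (is "?V \<le> _ * ?U")
    and "(\<integral>\<^sup>+ \<omega>. Z \<omega> * ennreal (\<phi> (X t \<omega>)) * indicator A \<omega> \<partial>P) \<le>
      ennreal (exp (4 * \<delta>)) * (\<integral>\<^sup>+ \<omega>. Z \<omega> * ennreal (\<phi> (X T \<omega>)) * indicator A \<omega> \<partial>P)"
proof -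
  have "?V \<le> ennreal (exp (4 * \<delta>)) * ?U \<and> ?U \<le> ennreal (exp (4 * \<delta>)) * ?V"
  proof (cases "t = T")
    case True
    \<comment> \<open>At \<open>t = T\<close> no half-open interval between exits contains
      \<open>t\<close>, but the two integrals coincide.\<close>
    have "1 * ?V \<le> ennreal (exp (4 * \<delta>)) * ?V"
      using \<delta> by (intro mult_right_mono) simp_all
    with True show ?thesis by simp
  next
    case False
    with t have "t < T" by simp
    have "A \<in> sets P" using A sets_F by blast
    note eq = nn_integral_split_exits[OF t(1) \<open>t < T\<close> this
        borel_measurable_times_ennreal[OF measurable_Z measurable_\<phi>_X_P]]
    show ?thesis
      unfolding eq ennreal_suminf_cmult[symmetric]
      by (intro conjI suminf_le nn_integral_\<phi>_between_exits[OF t(1) \<open>t < T\<close> A refl]) simp_all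
  qed
  then show "?V \<le> ennreal (exp (4 * \<delta>)) * ?U" "?U \<le> ennreal (exp (4 * \<delta>)) * ?V"
    by simp_all
qed

end

end

subsection \<open>Bounds on conditional expectations\<close>

text \<open>Test with the set \<open>A\<close> where the claim fails. The difference is nonnegative
  on \<open>A\<close> with nonpositive integral, so it vanishes there almost everywhere.\<close>

lemma (in sigma_finite_subalgebra) AE_real_cond_exp_le:
  assumes f: "integrable M f" and g: "integrable M g"
    and le: "\<And>A. A \<in> sets F \<Longrightarrow> (\<integral>x. indicator A x * f x \<partial>M) \<le> (\<integral>x. indicator A x * g x \<partial>M)"
  shows "AE x in M. real_cond_exp M F f x \<le> real_cond_exp M F g x"
proof -
  let ?f = "real_cond_exp M F f" and ?g = "real_cond_exp M F g"
  define A where "A = {x \<in> space F. ?g x < ?f x}"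
  have A: "A \<in> sets F"
    unfolding A_def by (intro borel_measurable_less borel_measurable_cond_exp)
  then have A_M: "A \<in> sets M"
    using subalg by (auto simp: subalgebra_def)
  have int: "integrable M (\<lambda>x. indicator A x * h x)" if "integrable M h" for h :: "'a \<Rightarrow> real"
    using integrable_mult_indicator[OF A_M that] by simp
  note f_meas = borel_measurable_integrable[OF f] and g_meas = borel_measurable_integrable[OF g]
  note int_f = real_cond_exp_intg[OF int[OF f] borel_measurable_indicator[OF A] f_meas]
  note int_g = real_cond_exp_intg[OF int[OF g] borel_measurable_indicator[OF A] g_meas]
  have int_diff: "integrable M (\<lambda>x. indicator A x * ?f x - indicator A x * ?g x)"
    by (intro Bochner_Integration.integrable_diff int_f(1) int_g(1))
  have nonneg: "0 \<le> indicator A x * ?f x - indicator A x * ?g x" for x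
    by (simp add: A_def indicator_def)
  have "(\<integral>x. indicator A x * ?f x - indicator A x * ?g x \<partial>M) =
      (\<integral>x. indicator A x * f x \<partial>M) - (\<integral>x. indicator A x * g x \<partial>M)"
    by (simp only: Bochner_Integration.integral_diff[OF int_f(1) int_g(1)] int_f(2) int_g(2))
  also have "\<dots> \<le> 0"
    using le[OF A] by simp
  finally have "(\<integral>x. indicator A x * ?f x - indicator A x * ?g x \<partial>M) = 0"
    by (intro order_antisym integral_nonneg_AE AE_I2 nonneg)
  then have "AE x in M. indicator A x * ?f x - indicator A x * ?g x = 0"
    unfolding integral_nonneg_eq_0_iff_AE[OF int_diff AE_I2[OF nonneg]] .
  with AE_space show ?thesis
  proof eventually_elim
    case (elim x)
    then have "x \<in> space F"
      using subalg by (simp add: subalgebra_def)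
    show ?case
    proof (rule ccontr)
      assume "\<not> ?f x \<le> ?g x"
      with \<open>x \<in> space F\<close> have "x \<in> A" by (simp add: A_def)
      with elim \<open>\<not> ?f x \<le> ?g x\<close> show False by simp
    qed
  qed
qed

text \<open>This is the passage from \<open>ennreal\<close> integrals, which need no integrability,
  to real conditional expectations. Finiteness for \<open>V\<close> passes to \<open>U\<close>
  through \<open>UV\<close> on the whole space.\<close>

lemma (in sigma_finite_subalgebra) AE_real_cond_exp_bounds:
  assumes U: "U \<in> borel_measurable F" and V: "V \<in> borel_measurable M"
    and nonneg: "\<And>x. 0 \<le> U x" "\<And>x. 0 \<le> V x" and c: "0 \<le> c"
    and finite: "(\<integral>\<^sup>+ x. ennreal (V x) \<partial>M) < \<infinity>"
    and VU: "\<And>A. A \<in> sets F \<Longrightarrow> (\<integral>\<^sup>+ x. ennreal (V x) * indicator A x \<partial>M) \<le> ennreal c * (\<integral>\<^sup>+ x. ennreal (U x) * indicator A x \<partial>M)"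
    and UV: "\<And>A. A \<in> sets F \<Longrightarrow> (\<integral>\<^sup>+ x. ennreal (U x) * indicator A x \<partial>M) \<le> ennreal c * (\<integral>\<^sup>+ x. ennreal (V x) * indicator A x \<partial>M)"
  shows "integrable M V" and "AE x in M. real_cond_exp M F V x \<le> c * U x \<and> U x \<le> c * real_cond_exp M F V x"
proof -
  have space: "space M \<in> sets F"
    using sets.top[of F] subalg unfolding subalgebra_def by simp
  have U_M: "U \<in> borel_measurable M"
    using subalg U by (rule measurable_from_subalg)
  have V_int: "integrable M V"
    using finite nonneg V by (intro integrableI_nonneg) auto
  have "(\<integral>\<^sup>+ x. ennreal (U x) \<partial>M) = (\<integral>\<^sup>+ x. ennreal (U x) * indicator (space M) x \<partial>M)"
    by (intro nn_integral_cong) simp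
  also have "\<dots> \<le> ennreal c * (\<integral>\<^sup>+ x. ennreal (V x) * indicator (space M) x \<partial>M)"
    by (rule UV[OF space])
  also have "(\<integral>\<^sup>+ x. ennreal (V x) * indicator (space M) x \<partial>M) = (\<integral>\<^sup>+ x. ennreal (V x) \<partial>M)"
    by (intro nn_integral_cong) simp
  also have "ennreal c * \<dots> < \<infinity>"
    using finite by (simp add: ennreal_mult_less_top)
  finally have U_int: "integrable M U"
    using nonneg U_M by (intro integrableI_nonneg) auto
  have conv: "(\<integral>x. indicator A x * h x \<partial>M) \<le> (\<integral>x. indicator A x * (c * g x) \<partial>M)"
    if A: "A \<in> sets F" and h: "integrable M h" "\<And>x. 0 \<le> h x" and g: "integrable M g" "\<And>x. 0 \<le> g x"
      and le: "(\<integral>\<^sup>+ x. ennreal (h x) * indicator A x \<partial>M) \<le> ennreal c * (\<integral>\<^sup>+ x. ennreal (g x) * indicator A x \<partial>M)"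
    for A h g
  proof -
    have A_M: "A \<in> sets M"
      using A subalg by (auto simp: subalgebra_def)
    have *: "(\<integral>\<^sup>+ x. ennreal (k x) * indicator A x \<partial>M) = ennreal (\<integral>x. indicator A x * k x \<partial>M)"
      if "integrable M k" "\<And>x. 0 \<le> k x" for k
    proof -
      have "(\<integral>\<^sup>+ x. ennreal (k x) * indicator A x \<partial>M) = (\<integral>\<^sup>+ x. ennreal (indicator A x * k x) \<partial>M)"
        by (intro nn_integral_cong) (simp add: indicator_def)
      also have "\<dots> = ennreal (\<integral>x. indicator A x * k x \<partial>M)"
        using integrable_mult_indicator[OF A_M that(1)] that(2) by (intro nn_integral_eq_integral) simp_all
      finally show ?thesis .
    qed
    have "ennreal (\<integral>x. indicator A x * h x \<partial>M) \<le> ennreal (c * (\<integral>x. indicator A x * g x \<partial>M))"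
      using le unfolding *[OF h] *[OF g] using c by (simp add: ennreal_mult')
    moreover have "0 \<le> c * (\<integral>x. indicator A x * g x \<partial>M)"
      using c g by (intro mult_nonneg_nonneg integral_nonneg_AE) simp_all
    ultimately have "(\<integral>x. indicator A x * h x \<partial>M) \<le> c * (\<integral>x. indicator A x * g x \<partial>M)"
      by (simp only: ennreal_le_iff)
    also have "\<dots> = (\<integral>x. c * (indicator A x * g x) \<partial>M)"
      by simp
    finally show ?thesis
      by (simp only: mult.left_commute)
  qed
  have "AE x in M. real_cond_exp M F V x \<le> real_cond_exp M F (\<lambda>x. c * U x) x"
    by (intro AE_real_cond_exp_le conv V_int U_int integrable_mult_right VU nonneg)
  moreover have "AE x in M. real_cond_exp M F (\<lambda>x. c * U x) x = c * U x"
    using U by (intro real_cond_exp_F_meas integrable_mult_right U_int borel_measurable_times borel_measurable_const)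
  moreover have "AE x in M. real_cond_exp M F U x \<le> real_cond_exp M F (\<lambda>x. c * V x) x"
    by (intro AE_real_cond_exp_le conv V_int U_int integrable_mult_right UV nonneg)
  moreover have "AE x in M. real_cond_exp M F U x = U x"
    by (intro real_cond_exp_F_meas U_int U)
  moreover have "AE x in M. real_cond_exp M F (\<lambda>x. c * V x) x = c * real_cond_exp M F V x"
    by (intro real_cond_exp_cmult V_int)
  ultimately show "AE x in M. real_cond_exp M F V x \<le> c * U x \<and> U x \<le> c * real_cond_exp M F V x"
    by eventually_elim simp
  show "integrable M V" by (rule V_int)
qed

section \<open>The normalised measure \<open>Q\<close>\<close>

context exit_density
begin

definition Q :: "'a measure" where
  "Q = density P (\<lambda>\<omega>. Z \<omega> / (\<integral>\<^sup>+ \<omega>. Z \<omega> \<partial>P))"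

lemma total_mass: "0 < (\<integral>\<^sup>+ \<omega>. Z \<omega> \<partial>P)" "(\<integral>\<^sup>+ \<omega>. Z \<omega> \<partial>P) < \<infinity>"
proof -
  show "(\<integral>\<^sup>+ \<omega>. Z \<omega> \<partial>P) < \<infinity>"
    using nn_integral_Z by (rule le_less_trans) simp
  show "0 < (\<integral>\<^sup>+ \<omega>. Z \<omega> \<partial>P)"
  proof (rule ccontr)
    assume "\<not> 0 < (\<integral>\<^sup>+ \<omega>. Z \<omega> \<partial>P)"
    then have "AE \<omega> in P. Z \<omega> = 0"
      by (simp add: nn_integral_0_iff_AE)
    with AE_Z have "AE \<omega> in P. False"
      by eventually_elim simp
    then show False by simp
  qed
qed

lemma space_Q: "space Q = space P" and sets_Q: "sets Q = sets P"
  by (simp_all add: Q_def)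

lemma nn_integral_Q:
  assumes "h \<in> borel_measurable P"
  shows "(\<integral>\<^sup>+ \<omega>. h \<omega> \<partial>Q) = inverse (\<integral>\<^sup>+ \<omega>. Z \<omega> \<partial>P) * (\<integral>\<^sup>+ \<omega>. Z \<omega> * h \<omega> \<partial>P)"
proof -
  let ?c = "\<integral>\<^sup>+ \<omega>. Z \<omega> \<partial>P"
  have "(\<integral>\<^sup>+ \<omega>. h \<omega> \<partial>Q) = (\<integral>\<^sup>+ \<omega>. Z \<omega> / ?c * h \<omega> \<partial>P)"
    unfolding Q_def
    by (intro nn_integral_density assms borel_measurable_divide_ennreal measurable_Z borel_measurable_const)
  also have "\<dots> = (\<integral>\<^sup>+ \<omega>. inverse ?c * (Z \<omega> * h \<omega>) \<partial>P)"
    by (intro nn_integral_cong) (simp only: divide_ennreal_def mult_ac)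
  also have "\<dots> = inverse ?c * (\<integral>\<^sup>+ \<omega>. Z \<omega> * h \<omega> \<partial>P)"
    by (intro nn_integral_cmult borel_measurable_times_ennreal measurable_Z assms)
  finally show ?thesis .
qed

lemma prob_space_Q: "prob_space Q"
proof (rule prob_spaceI)
  have "emeasure Q (space Q) = (\<integral>\<^sup>+ \<omega>. 1 \<partial>Q)"
    by simp
  also have "\<dots> = inverse (\<integral>\<^sup>+ \<omega>. Z \<omega> \<partial>P) * (\<integral>\<^sup>+ \<omega>. Z \<omega> * 1 \<partial>P)"
    by (rule nn_integral_Q) simp
  also have "\<dots> = (\<integral>\<^sup>+ \<omega>. Z \<omega> \<partial>P) / (\<integral>\<^sup>+ \<omega>. Z \<omega> \<partial>P)"
    unfolding divide_ennreal_def mult_1_right by (rule mult.commute)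
  also have "\<dots> = 1"
    using total_mass by (intro ennreal_divide_self) simp_all
  finally show "emeasure Q (space Q) = 1" .
qed

lemma absolutely_continuous_Q: "absolutely_continuous P Q" "absolutely_continuous Q P"
proof -
  have meas: "(\<lambda>\<omega>. Z \<omega> / (\<integral>\<^sup>+ \<omega>. Z \<omega> \<partial>P)) \<in> borel_measurable P"
    by (intro borel_measurable_divide_ennreal measurable_Z borel_measurable_const)
  then show "absolutely_continuous P Q"
    unfolding Q_def by (rule absolutely_continuousI_density)
  have pos: "AE \<omega> in P. 0 < Z \<omega> / (\<integral>\<^sup>+ \<omega>. Z \<omega> \<partial>P)"
    using AE_Z
  proof eventually_elim
    case (elim \<omega>)
    have "0 < inverse (\<integral>\<^sup>+ \<omega>. Z \<omega> \<partial>P)"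
      using total_mass(2) by (simp add: ennreal_inverse_positive)
    with elim show ?case
      unfolding divide_ennreal_def by (simp only: ennreal_zero_less_mult_iff simp_thms)
  qed
  show "absolutely_continuous Q P"
    unfolding absolutely_continuous_def
  proof
    fix N assume "N \<in> null_sets Q"
    then have N: "N \<in> sets P" "AE \<omega> in P. \<omega> \<in> N \<longrightarrow> Z \<omega> / (\<integral>\<^sup>+ \<omega>. Z \<omega> \<partial>P) = 0"
      unfolding Q_def null_sets_density_iff[OF meas] by simp_all
    from N(2) pos have "AE \<omega> in P. \<omega> \<notin> N"
      by eventually_elim auto
    with N(1) show "N \<in> null_sets P"
      by (simp add: AE_iff_null_sets)
  qed
qed

lemma subalgebra_Q: "subalgebra Q (F t)"
  by (simp add: subalgebra_def space_Q sets_Q space_F sets_F)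

lemma cond_exp_Q: "sigma_finite_subalgebra Q (F t)"
  by (intro finite_measure_subalgebra_is_sigma_finite finite_measure_subalgebra.intro
      finite_measure_subalgebra_axioms.intro subalgebra_Q prob_space.finite_measure[OF prob_space_Q])

text \<open>The same normalising constant stands on both sides of the comparisons under
  \<open>P\<close>, so they hold under \<open>Q\<close> on every set of \<open>F t\<close>. Testing
  on all these sets bounds the conditional expectation.\<close>

lemma cond_exp_near_process:
  fixes \<phi> :: "'b \<Rightarrow> real"
  assumes \<phi>: "\<phi> \<in> borel_measurable borel" "\<And>x. 0 \<le> \<phi> x" "\<And>x y. \<phi> x \<le> exp (dist x y) * \<phi> y"
    and w_\<phi>: "\<And>\<omega>. \<omega> \<in> space P \<Longrightarrow> w \<omega> * ennreal (\<phi> (X 0 \<omega>)) \<le> 1"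
    and t: "0 \<le> t" "t \<le> T"
  shows "integrable Q (\<lambda>\<omega>. \<phi> (X T \<omega>))"
    and "AE \<omega> in Q. real_cond_exp Q (F t) (\<lambda>\<omega>. \<phi> (X T \<omega>)) \<omega> \<le> exp (4 * \<delta>) * \<phi> (X t \<omega>) \<and>
      \<phi> (X t \<omega>) \<le> exp (4 * \<delta>) * real_cond_exp Q (F t) (\<lambda>\<omega>. \<phi> (X T \<omega>)) \<omega>"
proof -
  interpret Q: sigma_finite_subalgebra Q "F t" by (rule cond_exp_Q)
  note \<phi>_X = measurable_\<phi>_X_P[OF \<phi>]
  have Q_indicator: "(\<integral>\<^sup>+ \<omega>. ennreal (\<phi> (X s \<omega>)) * indicator A \<omega> \<partial>Q) =
      inverse (\<integral>\<^sup>+ \<omega>. Z \<omega> \<partial>P) * (\<integral>\<^sup>+ \<omega>. Z \<omega> * ennreal (\<phi> (X s \<omega>)) * indicator A \<omega> \<partial>P)"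
    if A: "A \<in> sets (F t)" for s A
  proof -
    have "A \<in> sets P" using A sets_F by blast
    then show ?thesis
      unfolding mult.assoc by (intro nn_integral_Q borel_measurable_times_ennreal \<phi>_X borel_measurable_indicator)
  qed
  have *: "(\<integral>\<^sup>+ \<omega>. ennreal (\<phi> (X r \<omega>)) * indicator A \<omega> \<partial>Q) \<le> c * (\<integral>\<^sup>+ \<omega>. ennreal (\<phi> (X s \<omega>)) * indicator A \<omega> \<partial>Q)"
    if "A \<in> sets (F t)" and le: "(\<integral>\<^sup>+ \<omega>. Z \<omega> * ennreal (\<phi> (X r \<omega>)) * indicator A \<omega> \<partial>P) \<le>
        c * (\<integral>\<^sup>+ \<omega>. Z \<omega> * ennreal (\<phi> (X s \<omega>)) * indicator A \<omega> \<partial>P)" for A r s c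
    unfolding Q_indicator[OF that(1)] mult.left_commute[of c] by (intro mult_left_mono le) simp
  have finite: "(\<integral>\<^sup>+ \<omega>. ennreal (\<phi> (X T \<omega>)) \<partial>Q) < \<infinity>"
  proof -
    have "(\<integral>\<^sup>+ \<omega>. Z \<omega> * ennreal (\<phi> (X T \<omega>)) \<partial>P) < top"
      using nn_integral_Z_\<phi>_finite[OF \<phi> w_\<phi>] by (rule le_less_trans) simp_all
    moreover have "inverse (\<integral>\<^sup>+ \<omega>. Z \<omega> \<partial>P) < top"
      using total_mass(1) by (simp add: less_top[symmetric])
    ultimately show ?thesis
      unfolding nn_integral_Q[OF \<phi>_X] by (simp add: ennreal_mult_less_top)
  qed
  have meas_T: "(\<lambda>\<omega>. \<phi> (X T \<omega>)) \<in> borel_measurable Q"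
    using measurable_F_P[OF measurable_\<phi>_X[OF \<phi>]] unfolding measurable_cong_sets[OF sets_Q refl] .
  note bounds = Q.AE_real_cond_exp_bounds[OF measurable_\<phi>_X[OF \<phi>] meas_T \<phi>(2) \<phi>(2) exp_ge_zero finite
      *[OF _ nn_integral_\<phi>_T(1)[OF \<phi> t]] *[OF _ nn_integral_\<phi>_T(2)[OF \<phi> t]]]
  show "integrable Q (\<lambda>\<omega>. \<phi> (X T \<omega>))"
    by (rule bounds(1))
  show "AE \<omega> in Q. real_cond_exp Q (F t) (\<lambda>\<omega>. \<phi> (X T \<omega>)) \<omega> \<le> exp (4 * \<delta>) * \<phi> (X t \<omega>) \<and>
      \<phi> (X t \<omega>) \<le> exp (4 * \<delta>) * real_cond_exp Q (F t) (\<lambda>\<omega>. \<phi> (X T \<omega>)) \<omega>"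
    by (rule bounds(2))
qed

end

subsection \<open>The logarithm of a sticky process\<close>

lemma component_le_maxnorm: "\<bar>x $ i\<bar> \<le> maxnorm x"
  unfolding maxnorm_def by (intro Max_ge) auto

lemma maxnorm_le_norm: "maxnorm x \<le> norm x"
  unfolding maxnorm_def by (intro Max.boundedI) (auto simp: component_le_norm_cart)

text \<open>Compactness of the path segment bounds the increments; without such a bound the real
  supremum in \<open>Sstar\<close> would carry no information.\<close>

lemma component_le_Sstar:
  fixes S :: "real \<Rightarrow> 'a \<Rightarrow> real ^ 'd"
  assumes cont: "continuous_on {0..T} (\<lambda>t. S t \<omega>)" and q: "0 \<le> q" and u: "u \<in> {q..T}"
  shows "\<bar>S u \<omega> $ i - S q \<omega> $ i\<bar> \<le> Sstar T S q \<omega>"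
proof -
  have "continuous_on {q..T} (\<lambda>u. S u \<omega> - S q \<omega>)"
    using q by (intro continuous_on_diff[OF continuous_on_subset[OF cont] continuous_on_const]) auto
  then have "compact ((\<lambda>u. S u \<omega> - S q \<omega>) ` {q..T})"
    by (rule compact_continuous_image) (rule compact_Icc)
  then have "bounded ((\<lambda>u. S u \<omega> - S q \<omega>) ` {q..T})"
    by (rule compact_imp_bounded)
  then obtain B where "\<forall>x\<in>(\<lambda>u. S u \<omega> - S q \<omega>) ` {q..T}. norm x \<le> B"
    unfolding bounded_iff ..
  then have "maxnorm (S u \<omega> - S q \<omega>) \<le> B" if "u \<in> {q..T}" for u
    using that by (intro order_trans[OF maxnorm_le_norm]) simp
  then have "bdd_above ((\<lambda>u. maxnorm (S u \<omega> - S q \<omega>)) ` {q..T})"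
    by (rule bdd_aboveI2)
  then have "maxnorm (S u \<omega> - S q \<omega>) \<le> Sstar T S q \<omega>"
    unfolding Sstar_def using u by (intro cSUP_upper)
  moreover have "\<bar>S u \<omega> $ i - S q \<omega> $ i\<bar> \<le> maxnorm (S u \<omega> - S q \<omega>)"
    using component_le_maxnorm[of "S u \<omega> - S q \<omega>" i] by simp
  ultimately show ?thesis by simp
qed

text \<open>If \<open>K\<close> is not measurable, then its conditional expectation is nonpositive by the junk value
  \<open>nn_cond_exp = 0\<close>, so the positivity assumption excludes this case.\<close>

lemma null_sets_if_cond_exp_indicator_pos:
  assumes "prob_space P" and sub: "subalgebra P H" and B: "B \<in> sets H"
    and pos: "AE \<omega> in P. 0 < real_cond_exp P H (indicator K) \<omega>"
    and disjoint: "AE \<omega> in P. \<omega> \<in> B \<longrightarrow> \<omega> \<notin> K" and K: "K \<subseteq> space P"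
  shows "B \<in> null_sets P"
proof -
  interpret prob_space P by fact
  interpret sigma_finite_subalgebra P H
    by (intro finite_measure_subalgebra_is_sigma_finite finite_measure_subalgebra.intro
        finite_measure_subalgebra_axioms.intro sub) unfold_locales
  have B_P: "B \<in> sets P"
    using B sub by (auto simp: subalgebra_def)
  have K_P: "K \<in> sets P"
  proof (rule ccontr)
    assume "K \<notin> sets P"
    moreover have "(\<lambda>\<omega>. ennreal (indicator K \<omega>)) \<notin> borel_measurable P" if "K \<notin> sets P"
    proof
      assume meas: "(\<lambda>\<omega>. ennreal (indicator K \<omega>)) \<in> borel_measurable P"
      have "(\<lambda>\<omega>. ennreal (indicator K \<omega>)) -` {1} \<inter> space P \<in> sets P"
        using meas by (rule measurable_sets) simp
      also have "(\<lambda>\<omega>. ennreal (indicator K \<omega>)) -` {1} \<inter> space P = K"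
        using K by (auto simp: indicator_def split: if_splits)
      finally show False using that by simp
    qed
    ultimately have le: "real_cond_exp P H (indicator K) \<omega> \<le> 0" for \<omega>
      by (simp add: real_cond_exp_def nn_cond_exp_def[of P H "\<lambda>\<omega>. ennreal (indicator K \<omega>)"])
    have "AE \<omega> in P. False"
      using pos
    proof eventually_elim
      case (elim \<omega>)
      with le[of \<omega>] show ?case by linarith
    qed
    then show False by simp
  qed
  have int: "integrable P (\<lambda>\<omega>. indicator B \<omega> * indicator K \<omega> :: real)"
    using B_P K_P by (intro integrable_mult_indicator[where 'b = real, unfolded real_scaleR_def] integrable_real_indicator)
      (simp_all add: emeasure_eq_measure)
  note cond = real_cond_exp_intg[OF int borel_measurable_indicator[OF B] borel_measurable_indicator[OF K_P]]
  \<comment> \<open>As \<open>B\<close> and \<open>K\<close> are almost disjoint, the positive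
    conditional probability integrates to 0 over \<open>B\<close>, which leaves \<open>B\<close> no
    mass.\<close>
  have "(\<integral>\<omega>. indicator B \<omega> * real_cond_exp P H (indicator K) \<omega> \<partial>P) = (\<integral>\<omega>. indicator B \<omega> * indicator K \<omega> \<partial>P)"
    by (rule cond(2))
  also have "\<dots> = (\<integral>\<omega>. 0 \<partial>P)"
  proof (rule integral_cong_AE)
    show "AE \<omega> in P. indicator B \<omega> * indicator K \<omega> = (0::real)"
      using disjoint by eventually_elim (simp add: indicator_def)
  qed (use int in simp_all)
  finally have "(\<integral>\<omega>. indicator B \<omega> * real_cond_exp P H (indicator K) \<omega> \<partial>P) = 0"
    by simp
  moreover have "AE \<omega> in P. 0 \<le> indicator B \<omega> * real_cond_exp P H (indicator K) \<omega>"
    using pos by eventually_elim simp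
  ultimately have "AE \<omega> in P. indicator B \<omega> * real_cond_exp P H (indicator K) \<omega> = 0"
    using integral_nonneg_eq_0_iff_AE[OF cond(1)] by blast
  with pos have "AE \<omega> in P. \<omega> \<notin> B"
    by eventually_elim (auto simp: indicator_def split: if_splits)
  with B_P show ?thesis
    by (simp add: AE_iff_null_sets)
qed

text \<open>The lower bound \<open>m\<close> turns absolute closeness into relative closeness. The
  Euclidean distance is at most the sum of the coordinate distances, so each coordinate is allowed
  an equal share of \<epsilon>.\<close>

lemma dist_ln_less:
  fixes x y :: "real ^ 'd"
  assumes m: "0 < m" "\<And>i. m < y $ i" and \<epsilon>: "0 < \<epsilon>"
    and close: "\<And>i. \<bar>x $ i - y $ i\<bar> < (1 - exp (- (\<epsilon> / CARD('d)))) * m"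
  shows "dist (\<chi> i. ln (x $ i)) (\<chi> i. ln (y $ i)) < \<epsilon>"
proof -
  define \<kappa> where "\<kappa> = \<epsilon> / CARD('d)"
  have \<kappa>: "0 < \<kappa>" using \<epsilon> by (simp add: \<kappa>_def)
  have comp: "\<bar>ln (x $ i) - ln (y $ i)\<bar> < \<kappa>" for i
  proof -
    have y: "0 < y $ i" using m(1) m(2)[of i] by linarith
    have "(1 - exp (- \<kappa>)) * m \<le> (1 - exp (- \<kappa>)) * y $ i"
      using m(2)[of i] \<kappa> by (intro mult_left_mono) simp_all
    with close[of i] have "\<bar>x $ i - y $ i\<bar> < (1 - exp (- \<kappa>)) * y $ i"
      unfolding \<kappa>_def by linarith
    then have lower: "exp (- \<kappa>) * y $ i < x $ i" and upper: "x $ i < (2 - exp (- \<kappa>)) * y $ i"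
      by (simp_all add: algebra_simps abs_less_iff)
    \<comment> \<open>This is cosh \<kappa> \<ge> 1. The relative error
      \<open>1 - exp (- \<kappa>)\<close>, exact for downward moves, is thereby also small enough
      for upward moves.\<close>
    have "2 - exp (- \<kappa>) \<le> exp \<kappa>"
    proof -
      have "1 + \<kappa> \<le> exp \<kappa>" "1 + (- \<kappa>) \<le> exp (- \<kappa>)"
        by (rule exp_ge_add_one_self)+
      then show ?thesis by linarith
    qed
    then have "(2 - exp (- \<kappa>)) * y $ i \<le> exp \<kappa> * y $ i"
      using y by (intro mult_right_mono) simp_all
    with upper have upper: "x $ i < exp \<kappa> * y $ i" by linarith
    have "0 < exp (- \<kappa>) * y $ i" using y by simp
    with lower have x: "0 < x $ i" by linarith
    have "ln (exp (- \<kappa>) * y $ i) < ln (x $ i)"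
      using lower x y by simp
    moreover have "ln (x $ i) < ln (exp \<kappa> * y $ i)"
      using upper x y by simp
    ultimately show ?thesis
      using y by (simp add: ln_mult abs_less_iff)
  qed
  have "dist (\<chi> i. ln (x $ i)) (\<chi> i. ln (y $ i)) \<le> (\<Sum>i\<in>UNIV. \<bar>ln (x $ i) - ln (y $ i)\<bar>)"
    using norm_le_l1_cart[of "(\<chi> i. ln (x $ i)) - (\<chi> i. ln (y $ i))"] by (simp add: dist_norm)
  also have "\<dots> < (\<Sum>i\<in>(UNIV :: 'd set). \<kappa>)"
    by (intro sum_strict_mono comp) simp_all
  also have "\<dots> = \<epsilon>"
    by (simp add: \<kappa>_def)
  finally show ?thesis .
qed

lemma borel_measurable_vec_lambda:
  fixes f :: "'a \<Rightarrow> 'd::finite \<Rightarrow> real"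
  assumes "\<And>i. (\<lambda>\<omega>. f \<omega> i) \<in> borel_measurable M"
  shows "(\<lambda>\<omega>. \<chi> i. f \<omega> i) \<in> borel_measurable M"
  unfolding borel_measurable_euclidean_space[of "\<lambda>\<omega>. \<chi> i. f \<omega> i"]
  using assms by (auto simp: Basis_vec_def inner_axis)

lemma borel_measurable_vec_nth: "(\<lambda>x. x $ i) \<in> borel_measurable (borel :: (real ^ 'd) measure)"
  by (intro borel_measurable_continuous_onI continuous_on_component continuous_on_id)

text \<open>Stickiness of \<open>S\<close> has a deterministic absolute threshold, whereas
  logarithms require relative closeness. Hence \<open>A\<close> is exhausted by the sets
  \<open>B n\<close>, on which all coordinates of \<open>S q\<close> exceed a constant and one
  threshold works throughout.\<close>

lemma sticky_process_ln:
  fixes P :: "'a measure" and F :: "real \<Rightarrow> 'a measure" and S :: "real \<Rightarrow> 'a \<Rightarrow> real ^ 'd"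
  assumes T: "T > 0"
    and usual: "usual_filtered_prob_space P F T"
    and adapted: "adapted F T S"
    and cont: "\<forall>\<omega>\<in>space P. continuous_on {0..T} (\<lambda>t. S t \<omega>)"
    and pos: "\<forall>t\<in>{0..T}. \<forall>\<omega>\<in>space P. \<forall>i. S t \<omega> $ i > 0"
    and sticky: "sticky P F T S"
  shows "sticky_process P (\<lambda>t. F (max 0 (min T t))) (\<lambda>t \<omega>. \<chi> i. ln (S (max 0 (min T t)) \<omega> $ i)) T"
proof -
  \<comment> \<open>Freezing time outside \<open>{0..T}\<close> extends the filtration and the
    continuous paths to the whole real line.\<close>
  let ?c = "\<lambda>t. max 0 (min T t)"
  have c: "?c t \<in> {0..T}" for t
    using T by auto
  note usual' = usual[unfolded usual_filtered_prob_space_def]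
  have prob: "prob_space P"
    using usual' by (rule conjunct1)
  note F = usual'[THEN conjunct2, THEN conjunct2, THEN conjunct1, THEN bspec]
    and mono = usual'[THEN conjunct2, THEN conjunct2, THEN conjunct2, THEN conjunct1, rule_format]
  interpret prob_space P by (rule prob)
  have comp: "(\<lambda>\<omega>. S t \<omega> $ i) \<in> borel_measurable (F t)" if "t \<in> {0..T}" for t i
    using that adapted unfolding adapted_def by (intro measurable_compose[OF _ borel_measurable_vec_nth]) blast
  show ?thesis
  proof (intro sticky_process.intro continuous_process.intro sticky_process_axioms.intro
      continuous_process_axioms.intro filtration.intro prob)
    show "space (F (?c t)) = space P" for t
      using F[OF c] by blast
    show "sets (F (?c s)) \<subseteq> sets (F (?c t))" if "s \<le> t" for s t
      using that by (intro mono c) auto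
    show "sets (F (?c t)) \<subseteq> sets P" for t
      using F[OF c] by blast
    show "0 < T" by (rule T)
    show "(\<lambda>\<omega>. \<chi> i. ln (S (?c t) \<omega> $ i)) \<in> borel_measurable (F (?c t))" for t
      by (intro borel_measurable_vec_lambda borel_measurable_ln comp c)
    show "continuous_on UNIV (\<lambda>t. \<chi> i. ln (S (?c t) \<omega> $ i))" if "\<omega> \<in> space P" for \<omega>
    proof (intro continuous_on_vec_lambda continuous_on_ln ballI)
      fix i t
      show "S (?c t) \<omega> $ i \<noteq> 0"
        using pos[rule_format, OF c that, of t i] by (rule less_imp_neq[symmetric])
      show "continuous_on UNIV (\<lambda>t. S (?c t) \<omega> $ i)"
      proof (intro continuous_on_component)
        show "continuous_on UNIV (\<lambda>t. S (?c t) \<omega>)"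
        proof (rule continuous_on_compose2[OF bspec[OF cont that]])
          show "continuous_on UNIV ?c"
            by (intro continuous_on_max continuous_on_min continuous_on_const continuous_on_id)
        qed (use c in blast)
      qed
    qed
    fix q \<epsilon> :: real and A
    assume q: "0 \<le> q" "q < T" and \<epsilon>: "0 < \<epsilon>" and A: "A \<in> sets (F (?c q))"
      and AE: "AE \<omega> in P. \<omega> \<in> A \<longrightarrow>
        (\<exists>u\<in>{q..T}. \<epsilon> \<le> dist (\<chi> i. ln (S (?c u) \<omega> $ i)) (\<chi> i. ln (S (?c q) \<omega> $ i)))"
    have c_q: "?c q = q" using q by simp
    have sub: "subalgebra P (F q)"
      using F[of q] q by (simp add: subalgebra_def)
    have A_space: "A \<subseteq> space P"
      using sets.sets_into_space[OF A] F[OF c] by blast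
    define m where "m n = inverse (real (Suc n))" for n
    have m: "0 < m n" for n by (simp add: m_def)
    define B where "B n = A \<inter> {\<omega> \<in> space (F q). \<forall>i. m n < S q \<omega> $ i}" for n
    have B_null: "B n \<in> null_sets P" for n
    proof (rule null_sets_if_cond_exp_indicator_pos[OF prob sub])
      let ?\<rho> = "(1 - exp (- (\<epsilon> / CARD('d)))) * m n"
      let ?K = "{\<omega> \<in> space P. Sstar T S q \<omega> < ?\<rho>}"
      have "{\<omega> \<in> space (F q). \<forall>i\<in>UNIV. m n < S q \<omega> $ i} \<in> sets (F q)"
        using q by (intro sets.sets_Collect_finite_All borel_measurable_less borel_measurable_const comp) auto
      then show "B n \<in> sets (F q)"
        using A c_q unfolding B_def by (intro sets.Int) simp_all
      have "0 < ?\<rho>"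
        using \<epsilon> m by (intro mult_pos_pos) simp_all
      with sticky q show "AE \<omega> in P. 0 < real_cond_exp P (F q) (indicator ?K) \<omega>"
        unfolding sticky_def by force
      show "?K \<subseteq> space P" by blast
      show "AE \<omega> in P. \<omega> \<in> B n \<longrightarrow> \<omega> \<notin> ?K"
        using AE
      proof eventually_elim
        case (elim \<omega>)
        show ?case
        proof (intro impI notI)
          assume \<omega>: "\<omega> \<in> B n" "\<omega> \<in> ?K"
          then have "\<omega> \<in> A" and lower: "m n < S q \<omega> $ i" for i
            by (simp_all add: B_def)
          from elim \<open>\<omega> \<in> A\<close> obtain u where u: "u \<in> {q..T}"
            and far: "\<epsilon> \<le> dist (\<chi> i. ln (S (?c u) \<omega> $ i)) (\<chi> i. ln (S (?c q) \<omega> $ i))" by blast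
          have c_u: "?c u = u" using u q by simp
          have "\<bar>S u \<omega> $ i - S q \<omega> $ i\<bar> < ?\<rho>" for i
            using component_le_Sstar[of T S \<omega> q u i] cont \<omega>(2) q(1) u by force
          then have "dist (\<chi> i. ln (S u \<omega> $ i)) (\<chi> i. ln (S q \<omega> $ i)) < \<epsilon>"
            by (rule dist_ln_less[OF m lower \<epsilon>])
          with far show False
            unfolding c_u c_q by simp
        qed
      qed
    qed
    have "A = (\<Union>n. B n)"
    proof
      show "(\<Union>n. B n) \<subseteq> A" by (auto simp: B_def)
      show "A \<subseteq> (\<Union>n. B n)"
      proof
        fix \<omega> assume \<omega>: "\<omega> \<in> A"
        then have \<omega>_P: "\<omega> \<in> space P" using A_space by blast
        \<comment> \<open>A minimum of finitely many positive coordinates is positive, so some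
          \<open>m n\<close> lies below it.\<close>
        define y where "y = Min (range (\<lambda>i. S q \<omega> $ i))"
        have "y \<in> range (\<lambda>i. S q \<omega> $ i)"
          unfolding y_def by (intro Min_in) auto
        then have "0 < y"
          using pos \<omega>_P q by auto
        then obtain n where n: "inverse (real (Suc n)) < y"
          using reals_Archimedean by blast
        have "m n < S q \<omega> $ i" for i
        proof -
          have "y \<le> S q \<omega> $ i" unfolding y_def by (intro Min_le) auto
          with n show ?thesis by (simp only: m_def less_le_trans)
        qed
        then have "\<omega> \<in> B n"
          using \<omega> \<omega>_P F[of q] q by (auto simp: B_def)
        then show "\<omega> \<in> (\<Union>n. B n)" by blast
      qed
    qed
    then show "A \<in> null_sets P"
      using null_sets_UN[OF B_null] by (simp only:)
  qed
qed

subsection \<open>Existence of consistent price systems\<close>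

theorem theorem1:
  fixes P :: "'a measure" and F :: "real \<Rightarrow> 'a measure" and T :: real
    and S :: "real \<Rightarrow> 'a \<Rightarrow> real ^ 'd"
  assumes "T > 0"
    and "usual_filtered_prob_space P F T"
    and "adapted F T S"
    and "\<forall>\<omega>\<in>space P. continuous_on {0..T} (\<lambda>t. S t \<omega>)"
    and "\<forall>t\<in>{0..T}. \<forall>\<omega>\<in>space P. \<forall>i. S t \<omega> $ i > 0"
    and "sticky P F T S"
  shows "\<forall>\<epsilon>>0. \<exists>M. eps_CPS P F T \<epsilon> S M"
proof (intro allI impI)
  fix \<epsilon> :: real assume \<epsilon>: "0 < \<epsilon>"
  define c where "c t = max 0 (min T t)" for t
  have c: "c t = t" if "t \<in> {0..T}" for t
    using that by (simp add: c_def)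
  define X where "X t \<omega> = (\<chi> i. ln (S (c t) \<omega> $ i))" for t \<omega>
  \<comment> \<open>This weight is known at time 0, is at most 1, and remains at most 1 when
    multiplied by any coordinate of \<open>S 0\<close>.\<close>
  define w where "w \<omega> = ennreal (1 / (1 + (\<Sum>i\<in>UNIV. \<bar>S 0 \<omega> $ i\<bar>)))" for \<omega>
  define \<delta> where "\<delta> = ln (1 + \<epsilon>) / 4"
  have w_pos: "0 < 1 + (\<Sum>i\<in>UNIV. \<bar>S 0 \<omega> $ i\<bar>)" for \<omega>
    by (intro add_pos_nonneg sum_nonneg) simp_all
  interpret sticky_process P "\<lambda>t. F (c t)" X T
    unfolding c_def X_def by (rule sticky_process_ln[OF assms])
  have S_0: "(\<lambda>\<omega>. S 0 \<omega> $ i) \<in> borel_measurable (F (c 0))" for i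
    using assms(1,3) c[of 0] unfolding adapted_def
    by (intro measurable_compose[OF _ borel_measurable_vec_nth]) simp
  interpret exit_density P "\<lambda>t. F (c t)" X T \<delta> w
  proof (intro exit_density.intro exit_density_axioms.intro sticky_process_axioms)
    show "0 < \<delta>" using \<epsilon> by (simp add: \<delta>_def)
    show "w \<in> borel_measurable (F (c 0))"
      unfolding w_def
      by (intro measurable_compose[OF _ measurable_ennreal] borel_measurable_divide borel_measurable_add
          borel_measurable_sum borel_measurable_abs S_0 borel_measurable_const)
    show "0 < w \<omega>" for \<omega>
      using w_pos[of \<omega>] by (simp add: w_def)
    have "1 / (1 + (\<Sum>i\<in>UNIV. \<bar>S 0 \<omega> $ i\<bar>)) \<le> 1" for \<omega>
      using w_pos[of \<omega>] by (simp add: sum_nonneg)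
    then show "w \<omega> \<le> 1" for \<omega>
      unfolding w_def by (metis ennreal_1 ennreal_leI)
  qed
  have exp4: "exp (4 * \<delta>) = 1 + \<epsilon>"
    using \<epsilon> by (simp add: \<delta>_def)
  have exp_X: "exp (X t \<omega> $ i) = S t \<omega> $ i" if "t \<in> {0..T}" "\<omega> \<in> space P" for t \<omega> i
    using that assms(5) by (simp add: X_def c)
  let ?\<phi> = "\<lambda>i (x :: real ^ 'd). exp (x $ i)"
  \<comment> \<open>Plain \<open>F t\<close> is used instead of the clamped filtration; the two
    agree on \<open>{0..T}\<close>. The martingale property becomes the tower property.\<close>
  define M where "M t \<omega> = (\<chi> i. real_cond_exp Q (F t) (\<lambda>\<omega>. ?\<phi> i (X T \<omega>)) \<omega>)" for t \<omega>
  have \<phi>: "?\<phi> i \<in> borel_measurable borel" "0 \<le> ?\<phi> i x" "?\<phi> i x \<le> exp (dist x y) * ?\<phi> i y" for i x y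
  proof -
    show "?\<phi> i \<in> borel_measurable borel"
      by (intro measurable_compose[OF borel_measurable_vec_nth borel_measurable_exp])
    \<comment> \<open>The Euclidean distance dominates each coordinate difference, so the
      exponential of a coordinate qualifies as \<phi>.\<close>
    have "x $ i - y $ i \<le> dist x y"
      using component_le_norm_cart[of "x - y" i] by (simp add: dist_norm)
    then show "?\<phi> i x \<le> exp (dist x y) * ?\<phi> i y"
      by (simp add: exp_add[symmetric])
  qed simp
  have w_\<phi>: "w \<omega> * ennreal (?\<phi> i (X 0 \<omega>)) \<le> 1" if "\<omega> \<in> space P" for i \<omega>
  proof -
    have "\<bar>S 0 \<omega> $ i\<bar> \<le> (\<Sum>i\<in>UNIV. \<bar>S 0 \<omega> $ i\<bar>)"
      by (intro member_le_sum) simp_all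
    then have "1 / (1 + (\<Sum>i\<in>UNIV. \<bar>S 0 \<omega> $ i\<bar>)) * S 0 \<omega> $ i \<le> 1"
      using w_pos[of \<omega>] by (simp add: divide_le_eq)
    then have "ennreal (1 / (1 + (\<Sum>i\<in>UNIV. \<bar>S 0 \<omega> $ i\<bar>)) * S 0 \<omega> $ i) \<le> 1"
      by (metis ennreal_1 ennreal_leI)
    with that w_pos[of \<omega>] assms(1) show ?thesis
      unfolding w_def by (subst ennreal_mult'[symmetric]) (simp_all add: exp_X)
  qed
  have near: "AE \<omega> in Q. M t \<omega> $ i \<le> (1 + \<epsilon>) * S t \<omega> $ i \<and> S t \<omega> $ i \<le> (1 + \<epsilon>) * M t \<omega> $ i"
    if t: "t \<in> {0..T}" for t i
  proof -
    have "AE \<omega> in Q. M t \<omega> $ i \<le> (1 + \<epsilon>) * ?\<phi> i (X t \<omega>) \<and> ?\<phi> i (X t \<omega>) \<le> (1 + \<epsilon>) * M t \<omega> $ i"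
      using cond_exp_near_process(2)[of "?\<phi> i" t, OF \<phi> w_\<phi>] t unfolding exp4 by (simp add: M_def c)
    then show ?thesis
      using AE_space by eventually_elim (simp add: exp_X[OF t] space_Q)
  qed
  have sub: "subalgebra Q (F t)" and sub_T: "subalgebra (F t) (F s)" and cond: "sigma_finite_subalgebra Q (F t)"
    if "s \<in> {0..T}" "t \<in> {0..T}" "s \<le> t" for s t
    using subalgebra_Q[of t] cond_exp_Q[of t] sets_F_mono[of s t] space_F[of s] space_F[of t] that
    by (simp_all add: c subalgebra_def)
  have M_adapted: "adapted F T M"
    unfolding adapted_def M_def by (intro ballI borel_measurable_vec_lambda borel_measurable_cond_exp)
  have "martingale Q F T M"
    unfolding martingale_def
  proof (intro conjI ballI allI impI)
    have int: "integrable Q (\<lambda>\<omega>. ?\<phi> i (X T \<omega>))" for i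
      using cond_exp_near_process(1)[of "?\<phi> i" 0, OF \<phi> w_\<phi>] assms(1) by simp
    show "adapted F T M" by (rule M_adapted)
    show "integrable Q (\<lambda>\<omega>. M t \<omega> $ i)" if "t \<in> {0..T}" for t i
      unfolding M_def vec_lambda_beta
      by (rule sigma_finite_subalgebra.real_cond_exp_int(1)[OF cond[OF that that order_refl] int])
    show "AE \<omega> in Q. real_cond_exp Q (F s) (\<lambda>\<omega>. M t \<omega> $ i) \<omega> = M s \<omega> $ i"
      if st: "s \<in> {0..T}" "t \<in> {0..T}" "s \<le> t" for s t i
      unfolding M_def vec_lambda_beta
      by (rule sigma_finite_subalgebra.real_cond_exp_nested_subalg[OF cond[OF st(1) st(1) order_refl] sub[OF st] sub_T[OF st] int])
  qed
  moreover have "AE \<omega> in P. S t \<omega> $ i / (1 + \<epsilon>) \<le> M t \<omega> $ i \<and> M t \<omega> $ i \<le> (1 + \<epsilon>) * S t \<omega> $ i"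
    if "t \<in> {0..T}" for t i
  \<comment> \<open>The bounds hold almost surely under \<open>Q\<close>; null sets of
    \<open>Q\<close> are null under \<open>P\<close>, which transfers them.\<close>
  proof (rule absolutely_continuous_AE[OF sets_Q[symmetric] absolutely_continuous_Q(2)])
    show "AE \<omega> in Q. S t \<omega> $ i / (1 + \<epsilon>) \<le> M t \<omega> $ i \<and> M t \<omega> $ i \<le> (1 + \<epsilon>) * S t \<omega> $ i"
      using near[OF that, of i] by eventually_elim (use \<epsilon> in \<open>simp add: pos_divide_le_eq mult.commute\<close>)
  qed
  ultimately show "\<exists>M. eps_CPS P F T \<epsilon> S M"
    unfolding eps_CPS_def using M_adapted prob_space_Q space_Q sets_Q absolutely_continuous_Q by blast
qed

end
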